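(* Let $d_A,d_B,q\in\mathbb{N}$ and let $\{Z_i=(d_A,d_B,d_{C_i},p_i,h_i)\}_{i\in\{1,\dots,q\}}$ be a finite set of quantum circuit topologies such that for each $i$ either $p_i<2d_A^2(d_B-1)$ or $d_{C_i}<d_A$. Then there exist an element $\mathcal{E}_0\in\mathcal{C}^{\mathrm{e}}_{d_A,d_B,d_A}$ and a neighborhood $B(\mathcal{E}_0)\subset\mathcal{C}_{d_A,d_B}$ of $\mathcal{E}_0$ (in the subspace topology of $\mathcal{C}_{d_A,d_B}$) such that every $\mathcal{E}\in B(\mathcal{E}_0)$ satisfies $\mathcal{E}\notin\bigcup_{i=1}^q H(Z_i)$.
   Context: For $s\leqslant m$, $V_{s,m}=\{V\in\mathbb{C}^{m\times s}:V^{\ast}V=I\}$ (isometries). $\mathcal{C}_{d_A,d_B}$ is the set of positive semi-definite $C\in\mathbb{C}^{d_Ad_B\times d_Ad_B}$ (on $\mathbb{C}^{d_A}\otimes\mathbb{C}^{d_B}$) with $\mathrm{tr}_B C=\frac{1}{d_A}I$; $\mathcal{C}^{\mathrm{e}}_{d_A,d_B,r}$ is the set of its elements of rank $r$ that are extreme points of the convex set $\mathcal{C}_{d_A,d_B}$. A quantum circuit topology is a 5-tuple $Z=(d_A,d_B,d_C,p,h)$ with $d_A,d_B,d_C\in\mathbb{N}$, $d_Bd_C\geqslant d_A$, $p\in\mathbb{N}_0$, and $h:[0,2\pi]^p\to V_{d_A,d_Bd_C}$ a smooth function. For $V\in V_{d_A,d_Cd_B}$ define the channel $\mathcal{E}_V(M)=\mathrm{tr}_C(VMV^{\ast})$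 for $M\in\mathbb{C}^{d_A\times d_A}$, where $\mathrm{tr}_C(X)=\sum_{i=1}^{d_C}(\langle i|\otimes I_{d_B})X(|i\rangle\otimes I_{d_B})$, and set $T(V)=\frac{1}{d_A}\sum_{i,j=1}^{d_A}|i\rangle\langle j|\otimes\mathcal{E}_V(|i\rangle\langle j|)\in\mathbb{C}^{d_Ad_B\times d_Ad_B}$ (the Choi-state of $\mathcal{E}_V$). The set generated by $Z$ is $H(Z):=T(h([0,2\pi]^p))$. *)

theory Defs
  imports "HOL-Analysis.Analysis" "Jordan_Normal_Form.Schur_Decomposition" "Jordan_Normal_Form.DL_Rank"
begin

section \<open>Matrices on tensor products (index convention (a,b) maps to a*dB + b)\<close>

definition psd :: "complex mat \<Rightarrow> bool" where
  "psd C \<longleftrightarrow> dim_row C = dim_col C \<and> mat_adjoint C = C \<and>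
     (\<forall>v \<in> carrier_vec (dim_row C). conjugate v \<bullet> (C *\<^sub>v v) \<in> \<real> \<and>
                                      0 \<le> Re (conjugate v \<bullet> (C *\<^sub>v v)))"

definition ptrace_B :: "nat \<Rightarrow> nat \<Rightarrow> complex mat \<Rightarrow> complex mat" where
  "ptrace_B dA dB X = mat dA dA (\<lambda>(a, a'). \<Sum>b<dB. X $$ (a * dB + b, a' * dB + b))"

definition ptrace_C :: "nat \<Rightarrow> nat \<Rightarrow> complex mat \<Rightarrow> complex mat" where
  "ptrace_C dC dB X = mat dB dB (\<lambda>(b, b'). \<Sum>c<dC. X $$ (c * dB + b, c * dB + b'))"

definition choi_set :: "nat \<Rightarrow> nat \<Rightarrow> complex mat set" where
  "choi_set dA dB = {C \<in> carrier_mat (dA * dB) (dA * dB).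
      psd C \<and> ptrace_B dA dB C = (1 / of_nat dA) \<cdot>\<^sub>m 1\<^sub>m dA}"

definition extreme_mat :: "complex mat set \<Rightarrow> complex mat \<Rightarrow> bool" where
  "extreme_mat S C \<longleftrightarrow> C \<in> S \<and>
     (\<forall>A \<in> S. \<forall>B \<in> S. \<forall>t::real. 0 < t \<and> t < 1 \<and>
        C = complex_of_real t \<cdot>\<^sub>m A + complex_of_real (1 - t) \<cdot>\<^sub>m B \<longrightarrow> A = C \<and> B = C)"

definition choi_extreme_rank :: "nat \<Rightarrow> nat \<Rightarrow> nat \<Rightarrow> complex mat set" where
  "choi_extreme_rank dA dB r = {C. extreme_mat (choi_set dA dB) C \<and>
      vec_space.rank (dim_row C) C = r}"

definition isometries :: "nat \<Rightarrow> nat \<Rightarrow> complex mat set" where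
  "isometries s m = {V \<in> carrier_mat m s. mat_adjoint V * V = 1\<^sub>m s}"

definition channel :: "nat \<Rightarrow> nat \<Rightarrow> complex mat \<Rightarrow> complex mat \<Rightarrow> complex mat" where
  "channel dC dB V M = ptrace_C dC dB (V * M * mat_adjoint V)"

definition ketbra :: "nat \<Rightarrow> nat \<Rightarrow> nat \<Rightarrow> complex mat" where
  "ketbra n i j = mat n n (\<lambda>(a, b). if a = i \<and> b = j then 1 else 0)"

text \<open>T(V) = 1/dA sum_{i,j} |i><j| (x) E_V(|i><j|); the (i,j) block is E_V(|i><j|)/dA.\<close>
definition choi :: "nat \<Rightarrow> nat \<Rightarrow> nat \<Rightarrow> complex mat \<Rightarrow> complex mat" where
  "choi dA dB dC V = mat (dA * dB) (dA * dB) (\<lambda>(r, s).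
      (1 / of_nat dA) * (channel dC dB V (ketbra dA (r div dB) (s div dB))) $$ (r mod dB, s mod dB))"

definition cube :: "nat \<Rightarrow> (nat \<Rightarrow> real) set" where
  "cube p = {x. (\<forall>j<p. 0 \<le> x j \<and> x j \<le> 2 * pi) \<and> (\<forall>j\<ge>p. x j = 0)}"

primrec Ck_cube :: "nat \<Rightarrow> nat \<Rightarrow> ((nat \<Rightarrow> real) \<Rightarrow> real) \<Rightarrow> bool" where
  "Ck_cube p 0 g = continuous_on (cube p) g"
| "Ck_cube p (Suc k) g = (continuous_on (cube p) g \<and>
     (\<forall>j<p. \<exists>g'. (\<forall>x\<in>cube p.
         ((\<lambda>t. g (x(j := t))) has_real_derivative g' x) (at (x j) within {0..2 * pi}))
       \<and> Ck_cube p k g'))"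

definition smooth_cube :: "nat \<Rightarrow> ((nat \<Rightarrow> real) \<Rightarrow> real) \<Rightarrow> bool" where
  "smooth_cube p g \<longleftrightarrow> (\<forall>k. Ck_cube p k g)"

definition circuit_topology ::
  "nat \<Rightarrow> nat \<Rightarrow> nat \<Rightarrow> nat \<Rightarrow> ((nat \<Rightarrow> real) \<Rightarrow> complex mat) \<Rightarrow> bool" where
  "circuit_topology dA dB dC p h \<longleftrightarrow> 0 < dA \<and> 0 < dB \<and> 0 < dC \<and> dB * dC \<ge> dA \<and>
     (\<forall>x\<in>cube p. h x \<in> isometries dA (dB * dC)) \<and>
     (\<forall>a<dB * dC. \<forall>b<dA. smooth_cube p (\<lambda>x. Re (h x $$ (a, b))) \<and>
                          smooth_cube p (\<lambda>x. Im (h x $$ (a, b))))"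

definition generated_set :: "nat \<Rightarrow> nat \<Rightarrow> nat \<Rightarrow> nat \<Rightarrow> ((nat \<Rightarrow> real) \<Rightarrow> complex mat) \<Rightarrow> complex mat set" where
  "generated_set dA dB dC p h = choi dA dB dC ` h ` cube p"

definition mat_dist :: "complex mat \<Rightarrow> complex mat \<Rightarrow> real" where
  "mat_dist X Y = sqrt (\<Sum>i<dim_row X. \<Sum>j<dim_col X. (cmod (X $$ (i, j) - Y $$ (i, j)))\<^sup>2)"

end

(*
  Write the rows of a dA dB x dA matrix W as pairs (a, b), let its block b = 0 be the identity and
  keep its other entries small; they are 2 dA^2 (dB - 1) free real parameters. The trace condition on
  W P W^* is the linear system sum_b W_b P W_b^* = I / dA, a small perturbation of P = I / dA, so it
  has exactly one solution P, which is close to I / dA and hence positive definite. This gives a Choi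
  state of rank dA, and uniqueness of P is precisely its extremality. As W is recovered from W P W^*
  by a Lipschitz map, the parametrised family cannot be covered by finitely many Lipschitz images of
  cubes of smaller dimension: a grid with n^(2 dA^2 (dB - 1)) parameters is separated at scale 1/n,
  while a p-dimensional cube has only O(n^p) cells of that size. A circuit with fewer than dA Kraus
  operators produces a singular block b = b' = 0, so it misses the family. The generated
  sets are compact, hence a point outside them has positive distance to them.
*)
theory Submission
  imports Defs
begin

section \<open>Positive semidefinite matrices, rank and contractive linear systems\<close>

text \<open>The normalisation is carried by P and not by W. Demanding an isometry would put
  nonlinear constraints on the entries of W; with P solving a linear system, these entries range
  freely over a box, and counting grid points replaces any notion of dimension of a manifold. The
  bound \<open>1 / (2 dA^2 dB)\<close> on the small entries yields a chain of estimates. The map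
  sending Q to the sum of W_b Q W_b^* over b >= 1 has row sums at most \<open>1 / (4 dA)\<close>, so
  the trace system is uniquely solvable. Hence P differs from I / dA by at most
  \<open>1 / (2 dA^2)\<close> in each entry. Hence dA P - I has row sums at most 1/2, so P is
  invertible with a bound independent of W. This uniform bound makes the recovery of W Lipschitz:
  because of the identity block, P is the submatrix of W P W^* with b = b' = 0 and W P consists of
  its columns with b = 0, so only P has to be inverted. Finitely many circuits are handled at once
  by refining the grid until it has more points than all their cells together.\<close>

lemma dim_mat_adjoint [simp]:
  "dim_row (mat_adjoint A) = dim_col A" "dim_col (mat_adjoint A) = dim_row A"
  by (auto simp: mat_adjoint_def)

lemma index_mat_adjoint [simp]:
  fixes A :: "complex mat"
  assumes "i < dim_col A" "j < dim_row A"
  shows "mat_adjoint A $$ (i, j) = cnj (A $$ (j, i))"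
  using assms by (simp add: mat_adjoint_def mat_of_rows_def)

section \<open>Positive semidefiniteness through matrix entries\<close>

lemma quadratic_form_vec:
  assumes "A \<in> carrier_mat N N"
  shows "conjugate (vec N v) \<bullet> (A *\<^sub>v vec N v) =
    (\<Sum>i<N. \<Sum>j<N. cnj (v i) * A $$ (i, j) * v j)"
  using assms
  by (simp add: scalar_prod_def mult_mat_vec_def lessThan_atLeast0 sum_distrib_left mult.assoc)

text \<open>Reality of the form follows from Hermitian symmetry by swapping the two summation
  indices, so only the sign condition remains. Functions replace vectors, which turns later
  arguments into rearrangements of finite sums.\<close>

lemma psd_iff:
  assumes A: "A \<in> carrier_mat N N"
  shows "psd A \<longleftrightarrow> (\<forall>i<N. \<forall>j<N. A $$ (i, j) = cnj (A $$ (j, i))) \<and>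
    (\<forall>v. 0 \<le> Re (\<Sum>i<N. \<Sum>j<N. cnj (v i) * A $$ (i, j) * v j))"
    (is "_ \<longleftrightarrow> ?H \<and> (\<forall>v. 0 \<le> Re (?q v))")
proof -
  have adj: "mat_adjoint A = A \<longleftrightarrow> ?H"
  proof
    assume *: "mat_adjoint A = A"
    show ?H
    proof (intro allI impI)
      fix i j assume "i < N" "j < N"
      then show "A $$ (i, j) = cnj (A $$ (j, i))"
        using index_mat_adjoint[of i A j] * A by simp
    qed
  next
    assume *: ?H
    show "mat_adjoint A = A"
    proof (rule eq_matI)
      fix i j assume "i < dim_row A" "j < dim_col A"
      then have "i < N" "j < N" using A by auto
      then have "mat_adjoint A $$ (i, j) = cnj (A $$ (j, i))" using A by simp
      then show "mat_adjoint A $$ (i, j) = A $$ (i, j)" using * \<open>i < N\<close> \<open>j < N\<close> by metis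
    qed (use A in auto)
  qed
  have real: "?q v \<in> \<real>" if ?H for v
  proof -
    have "cnj (?q v) = (\<Sum>i<N. \<Sum>j<N. cnj (v j) * A $$ (j, i) * v i)"
      unfolding cnj_sum
    proof (intro sum.cong refl)
      fix i j assume "i \<in> {..<N}" "j \<in> {..<N}"
      then have "A $$ (j, i) = cnj (A $$ (i, j))" using that by blast
      then show "cnj (cnj (v i) * A $$ (i, j) * v j) = cnj (v j) * A $$ (j, i) * v i"
        by (simp add: mult_ac)
    qed
    also have "\<dots> = ?q v" by (rule sum.swap)
    finally show ?thesis by (simp add: Reals_cnj_iff)
  qed
  have vecs: "(\<forall>v \<in> carrier_vec N. P v) \<longleftrightarrow> (\<forall>f. P (vec N f))" for P :: "complex vec \<Rightarrow> bool"
  proof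
    assume "\<forall>f. P (vec N f)"
    show "\<forall>v \<in> carrier_vec N. P v"
    proof
      fix v :: "complex vec" assume "v \<in> carrier_vec N"
      then have "v = vec N (\<lambda>i. vec_index v i)" by auto
      then show "P v" using \<open>\<forall>f. P (vec N f)\<close> by metis
    qed
  qed auto
  have "dim_row A = N" "dim_col A = N" using A by auto
  then have "psd A \<longleftrightarrow> ?H \<and> (\<forall>v. ?q v \<in> \<real> \<and> 0 \<le> Re (?q v))"
    by (simp only: psd_def adj vecs quadratic_form_vec[OF A] simp_thms)
  then show ?thesis using real by blast
qed

text \<open>A null vector minimises the form. Subtracting \<open>t * z\<close> in coordinate
  \<open>r\<close>, where \<open>z\<close> is entry \<open>r\<close> of \<open>A v\<close>, lowers
  the form to first order unless \<open>z = 0\<close>. This transfers null vectors from a convex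
  combination to its components.\<close>

lemma psd_null_vector:
  fixes A :: "nat \<Rightarrow> nat \<Rightarrow> complex"
  assumes herm: "\<And>i j. i < N \<Longrightarrow> j < N \<Longrightarrow> A i j = cnj (A j i)"
    and pos: "\<And>v. 0 \<le> Re (\<Sum>i<N. \<Sum>j<N. cnj (v i) * A i j * v j)"
    and null: "Re (\<Sum>i<N. \<Sum>j<N. cnj (v i) * A i j * v j) = 0"
    and r: "r < N"
  shows "(\<Sum>j<N. A r j * v j) = 0"
proof (rule ccontr)
  define z where "z = (\<Sum>j<N. A r j * v j)"
  assume "(\<Sum>j<N. A r j * v j) \<noteq> 0"
  then have z0: "0 < (cmod z)\<^sup>2" by (simp add: z_def)
  have cz: "cnj z = (\<Sum>i<N. cnj (v i) * A i r)"
    unfolding z_def cnj_sum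
  proof (intro sum.cong refl)
    fix j assume "j \<in> {..<N}"
    then have "A j r = cnj (A r j)" using herm r by blast
    then show "cnj (A r j * v j) = cnj (v j) * A j r" by simp
  qed
  \<comment> \<open>The form changes by \<open>t * |z|^2 * (t * A r r - 2)\<close>. This
    \<open>t\<close> is positive and keeps \<open>t * A r r\<close> at most 1, so the change is
    negative.\<close>
  define t where "t = 1 / (\<bar>Re (A r r)\<bar> + 1)"
  define u where "u = (\<lambda>i. v i - (if i = r then of_real t * z else 0))"
  have inner: "(\<Sum>j<N. A i j * u j) = (\<Sum>j<N. A i j * v j) - A i r * (of_real t * z)" if "i < N" for i
    using r by (simp add: u_def right_diff_distrib sum_subtractf mult_delta_right)
  have "(\<Sum>i<N. \<Sum>j<N. cnj (u i) * A i j * u j) = (\<Sum>i<N. cnj (u i) * (\<Sum>j<N. A i j * u j))"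
    by (simp add: sum_distrib_left mult.assoc)
  also have "\<dots> = (\<Sum>i<N. cnj (v i) * (\<Sum>j<N. A i j * u j)
      - (if i = r then cnj (of_real t * z) * (\<Sum>j<N. A r j * u j) else 0))"
    by (intro sum.cong refl) (simp add: u_def left_diff_distrib)
  also have "\<dots> = (\<Sum>i<N. cnj (v i) * (\<Sum>j<N. A i j * u j)) - cnj (of_real t * z) * (\<Sum>j<N. A r j * u j)"
    using r by (simp add: sum_subtractf)
  also have "(\<Sum>i<N. cnj (v i) * (\<Sum>j<N. A i j * u j)) =
      (\<Sum>i<N. \<Sum>j<N. cnj (v i) * A i j * v j) - (\<Sum>i<N. cnj (v i) * A i r) * (of_real t * z)"
    by (simp add: inner right_diff_distrib sum_subtractf sum_distrib_left sum_distrib_right mult.assoc)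
  also have "(\<Sum>j<N. A r j * u j) = z - A r r * (of_real t * z)"
    using inner[OF r] by (simp add: z_def)
  finally have "(\<Sum>i<N. \<Sum>j<N. cnj (u i) * A i j * u j) =
     (\<Sum>i<N. \<Sum>j<N. cnj (v i) * A i j * v j) - of_real (2 * t) * (z * cnj z) + of_real (t\<^sup>2) * (z * cnj z) * A r r"
    unfolding cz[symmetric] by (simp add: algebra_simps power2_eq_square)
  then have "Re (\<Sum>i<N. \<Sum>j<N. cnj (u i) * A i j * u j) =
     0 - 2 * t * (cmod z)\<^sup>2 + t\<^sup>2 * (cmod z)\<^sup>2 * Re (A r r)"
    using null by (simp add: complex_norm_square[symmetric])
  also have "\<dots> = t * (cmod z)\<^sup>2 * (t * Re (A r r) - 2)"
    by (simp add: algebra_simps power2_eq_square)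
  also have "\<dots> < 0"
  proof -
    have "t > 0" by (simp add: t_def add_nonneg_pos)
    moreover have "Re (A r r) \<le> \<bar>Re (A r r)\<bar> + 1" by linarith
    then have "t * Re (A r r) \<le> 1" by (simp add: t_def divide_simps)
    ultimately show ?thesis using z0 by (simp add: mult_pos_neg)
  qed
  finally show False using pos[of u] by simp
qed

text \<open>Injectivity makes the columns of \<open>B\<close> independent, \<open>A = B * D\<close>
  puts the columns of \<open>A\<close> into their span, and \<open>sub\<close> gives the converse
  inclusion.\<close>

lemma (in vec_space) rank_eq_if_generated:
  assumes A: "A \<in> carrier_mat n m" and B: "B \<in> carrier_mat n k" and D: "D \<in> carrier_mat k m"
    and sub: "set (cols B) \<subseteq> set (cols A)" and AB: "A = B * D"
    and inj: "\<And>v. v \<in> carrier_vec k \<Longrightarrow> B *\<^sub>v v = 0\<^sub>v n \<Longrightarrow> v = 0\<^sub>v k"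
  shows "rank A = k"
proof -
  have unit: "B *\<^sub>v unit_vec k i = col B i" if "i < k" for i
    using B that by (intro eq_vecI) auto
  \<comment> \<open>Linear independence is a property of the set of columns, so repetitions are
    excluded first: they would put a difference of unit vectors into the kernel.\<close>
  have dist: "distinct (cols B)"
    unfolding distinct_conv_nth
  proof (intro allI impI)
    fix i j assume ij: "i < length (cols B)" "j < length (cols B)" "i \<noteq> j"
    then have ij': "i < k" "j < k" using B by auto
    show "cols B ! i \<noteq> cols B ! j"
    proof
      assume "cols B ! i = cols B ! j"
      then have eq: "col B i = col B j" using ij by simp
      have "B *\<^sub>v (unit_vec k i - unit_vec k j) = B *\<^sub>v unit_vec k i - B *\<^sub>v unit_vec k j"
        using B by (intro mult_minus_distrib_mat_vec) auto
      also have "\<dots> = 0\<^sub>v n"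
        using eq B ij' unit by simp
      finally have "unit_vec k i - unit_vec k j = (0\<^sub>v k :: 'a vec)"
        by (intro inj) auto
      then have "vec_index (unit_vec k i - unit_vec k j :: 'a vec) i = 0"
        using ij' by simp
      then show False using ij ij' by simp
    qed
  qed
  have cB: "set (cols B) \<subseteq> carrier_vec n" and cA: "set (cols A) \<subseteq> carrier_vec n"
    using A B cols_dim by blast+
  have "lin_indpt (set (cols B))"
    using lin_depE[OF B _ dist] inj by metis
  then have rB: "rank B = k" by (rule lin_indpt_full_rank[OF B dist])
  have "set (cols A) \<subseteq> span (set (cols B))"
  proof
    fix x assume "x \<in> set (cols A)"
    then obtain j where j: "j < m" "x = col A j"
      using A by (metis carrier_matD(2) cols_length cols_nth in_set_conv_nth)
    have "x = B *\<^sub>v col D j"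
      using j AB B D by auto
    also have "\<dots> = lincomb (\<lambda>a. vec_index (col D j) (find_first a (cols B))) (set (cols B))"
      using B D by (intro lincomb_eq_mat_mult[symmetric] dist) auto
    finally show "x \<in> span (set (cols B))" using in_spanI[of x _ "set (cols B)"] by blast
  qed
  then have "span (set (cols A)) = span (set (cols B))"
    using sub cA cB span_is_monotone[OF sub] span_is_subset span_is_submodule by (metis subset_antisym)
  then show ?thesis using rB by (simp add: rank_def)
qed

section \<open>Linear systems that are contractive perturbations of the identity\<close>

text \<open>Picard iteration for \<open>x = b - K x\<close>, started at 0. In the maximum norm
  \<open>K\<close> at least halves distances, so successive iterates differ by at most
  \<open>\<beta> * (1 / 2) ^ n\<close> and converge.\<close>

lemma contraction_system_solution:
  fixes K :: "'i \<Rightarrow> 'i \<Rightarrow> complex"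
  assumes fin: "finite I" and K: "\<And>i. i \<in> I \<Longrightarrow> (\<Sum>j\<in>I. cmod (K i j)) \<le> 1 / 2"
  shows "\<exists>x. \<forall>i\<in>I. x i + (\<Sum>j\<in>I. K i j * x j) = b i"
proof -
  define x where "x = rec_nat (\<lambda>_. 0) (\<lambda>_ y i. b i - (\<Sum>j\<in>I. K i j * y j))"
  have x0: "x 0 = (\<lambda>_. 0)" and xS: "x (Suc n) = (\<lambda>i. b i - (\<Sum>j\<in>I. K i j * x n j))" for n
    by (simp_all add: x_def)
  define \<beta> where "\<beta> = (\<Sum>i\<in>I. cmod (b i))"
  have step: "\<forall>i\<in>I. cmod (x (Suc n) i - x n i) \<le> \<beta> * (1 / 2) ^ n" for n
  proof (induction n)
    case 0
    show ?case using fin by (auto simp: xS x0 \<beta>_def intro!: member_le_sum)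
  next
    case (Suc n)
    show ?case
    proof
      fix i assume i: "i \<in> I"
      have "x (Suc (Suc n)) i = b i - (\<Sum>j\<in>I. K i j * x (Suc n) j)"
        and "x (Suc n) i = b i - (\<Sum>j\<in>I. K i j * x n j)"
        using xS[of "Suc n"] xS[of n] by metis+
      then have "x (Suc (Suc n)) i - x (Suc n) i = - (\<Sum>j\<in>I. K i j * (x (Suc n) j - x n j))"
        by (simp only: right_diff_distrib sum_subtractf) simp
      then have "cmod (x (Suc (Suc n)) i - x (Suc n) i) \<le> (\<Sum>j\<in>I. cmod (K i j) * cmod (x (Suc n) j - x n j))"
        by (simp add: norm_mult sum_norm_le del: norm_minus_commute)
      also have "\<dots> \<le> (\<Sum>j\<in>I. cmod (K i j) * (\<beta> * (1 / 2) ^ n))"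
        using Suc by (intro sum_mono mult_left_mono) auto
      also have "\<dots> \<le> 1 / 2 * (\<beta> * (1 / 2) ^ n)"
        unfolding sum_distrib_right[symmetric] using K[OF i]
        by (intro mult_right_mono) (auto simp: \<beta>_def intro!: mult_nonneg_nonneg sum_nonneg)
      finally show "cmod (x (Suc (Suc n)) i - x (Suc n) i) \<le> \<beta> * (1 / 2) ^ Suc n" by simp
    qed
  qed
  have "\<exists>l. (\<lambda>n. x n i) \<longlonglongrightarrow> l" if i: "i \<in> I" for i
  proof -
    have "summable (\<lambda>n. x (Suc n) i - x n i)"
    proof (rule summable_comparison_test)
      show "\<exists>N. \<forall>n\<ge>N. cmod (x (Suc n) i - x n i) \<le> \<beta> * (1 / 2) ^ n" using step i by blast
      show "summable (\<lambda>n. \<beta> * (1 / 2) ^ n)" by (intro summable_mult summable_geometric) simp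
    qed
    then have "convergent (\<lambda>n. \<Sum>k<n. x (Suc k) i - x k i)"
      by (simp add: summable_iff_convergent)
    then show ?thesis 
      by (simp add: sum_lessThan_telescope[of "\<lambda>n. x n i"] x0 convergent_def)
  qed
  then obtain l where l: "\<And>i. i \<in> I \<Longrightarrow> (\<lambda>n. x n i) \<longlonglongrightarrow> l i" by metis
  have "l i + (\<Sum>j\<in>I. K i j * l j) = b i" if i: "i \<in> I" for i
  proof -
    have "(\<lambda>n. x (Suc n) i) \<longlonglongrightarrow> b i - (\<Sum>j\<in>I. K i j * l j)"
      unfolding xS by (intro tendsto_intros l)
    moreover have "(\<lambda>n. x (Suc n) i) \<longlonglongrightarrow> l i" using l[OF i] by (rule LIMSEQ_Suc)
    ultimately have "l i = b i - (\<Sum>j\<in>I. K i j * l j)" using LIMSEQ_unique by blast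
    then show ?thesis by simp
  qed
  then show ?thesis by blast
qed

text \<open>At a coordinate of largest modulus \<open>m\<close> the perturbation is at most
  \<open>m / 2\<close>, so \<open>m / 2\<close> is at most \<open>\<beta>\<close>. With
  \<open>\<beta> = 0\<close> this is uniqueness; in general it bounds the inverse of
  \<open>I + K\<close> by 2.\<close>

lemma contraction_system_bound:
  fixes K :: "'i \<Rightarrow> 'i \<Rightarrow> complex"
  assumes fin: "finite I" and K: "\<And>i. i \<in> I \<Longrightarrow> (\<Sum>j\<in>I. cmod (K i j)) \<le> 1 / 2"
    and sol: "\<And>i. i \<in> I \<Longrightarrow> cmod (x i + (\<Sum>j\<in>I. K i j * x j)) \<le> \<beta>"
    and i: "i \<in> I"
  shows "cmod (x i) \<le> 2 * \<beta>"
proof -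
  define m where "m = Max ((\<lambda>i. cmod (x i)) ` I)"
  have le: "cmod (x j) \<le> m" if "j \<in> I" for j unfolding m_def using fin that by auto
  have "m \<in> (\<lambda>i. cmod (x i)) ` I" unfolding m_def using fin i by (intro Max_in) auto
  then obtain k where k: "k \<in> I" "m = cmod (x k)" by auto
  have "cmod (\<Sum>j\<in>I. K k j * x j) \<le> (\<Sum>j\<in>I. cmod (K k j) * cmod (x j))"
    by (simp add: norm_mult sum_norm_le)
  also have "\<dots> \<le> (\<Sum>j\<in>I. cmod (K k j) * m)" by (intro sum_mono mult_left_mono le) auto
  also have "\<dots> \<le> 1 / 2 * m" unfolding sum_distrib_right[symmetric]
    using K[OF k(1)] k by (intro mult_right_mono) auto
  finally have "cmod (\<Sum>j\<in>I. K k j * x j) \<le> m / 2" by simp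
  moreover have "cmod (x k) \<le> cmod (x k + (\<Sum>j\<in>I. K k j * x j)) + cmod (\<Sum>j\<in>I. K k j * x j)"
    by (metis add_diff_cancel_right' norm_triangle_ineq4)
  ultimately have "m \<le> 2 * \<beta>" using sol[OF k(1)] k by linarith
  then show ?thesis using le[OF i] by linarith
qed

section \<open>Lipschitz functions on cubes and a counting argument\<close>

text \<open>Coordinates from \<open>p\<close> on are pinned to 0, so the cube is a product of
  compact sets over all of \<open>nat\<close> and Tychonoff's theorem applies.\<close>

lemma compact_cube: "compact (cube p)"
proof -
  define S where "S = (\<lambda>j. if j < p then {0..2 * pi} else {0})"
  have "cube p = Pi\<^sub>E UNIV S"
  proof (rule Set.set_eqI)
    fix x
    have "(\<forall>j. x j \<in> S j) \<longleftrightarrow> (\<forall>j. (j < p \<longrightarrow> 0 \<le> x j \<and> x j \<le> 2 * pi) \<and> (j \<ge> p \<longrightarrow> x j = 0))"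
      by (rule iff_allI) (simp add: S_def not_less)
    then have "x \<in> cube p \<longleftrightarrow> (\<forall>j. x j \<in> S j)" by (auto simp only: cube_def mem_Collect_eq)
    then show "x \<in> cube p \<longleftrightarrow> x \<in> Pi\<^sub>E UNIV S" by (simp add: PiE_iff)
  qed
  moreover have "compactin (product_topology (\<lambda>_. euclidean) UNIV) (Pi\<^sub>E UNIV S)"
    by (simp add: compactin_PiE S_def)
  ultimately show ?thesis by (simp add: euclidean_product_topology)
qed

lemma zero_in_cube: "(\<lambda>_. 0) \<in> cube p"
  by (simp add: cube_def)

lemma cube_bounds: "x \<in> cube p \<Longrightarrow> 0 \<le> x j \<and> x j \<le> 2 * pi"
  by (cases "j < p") (auto simp: cube_def)

lemma cube_diff_bound: "x \<in> cube p \<Longrightarrow> y \<in> cube p \<Longrightarrow> \<bar>x j - y j\<bar> \<le> 2 * pi"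
  using cube_bounds[of x p j] cube_bounds[of y p j] by linarith

text \<open>The distance is the maximum over the first \<open>p\<close> coordinates, given through a
  bound \<open>\<delta>\<close>: this is what two points of the same grid cell provide.\<close>

definition cube_lipschitz :: "nat \<Rightarrow> ((nat \<Rightarrow> real) \<Rightarrow> complex) \<Rightarrow> bool" where
  "cube_lipschitz p f \<longleftrightarrow> (\<exists>L\<ge>0. \<forall>x\<in>cube p. \<forall>y\<in>cube p. \<forall>\<delta>\<ge>0.
     (\<forall>j<p. \<bar>x j - y j\<bar> \<le> \<delta>) \<longrightarrow> cmod (f x - f y) \<le> L * \<delta>)"

text \<open>Walk from \<open>x\<close> to \<open>y\<close> one coordinate at a time. Each step is a
  one-dimensional mean value estimate, and compactness of the cube bounds the partial
  derivatives.\<close>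

lemma Ck_cube_imp_lipschitz:
  assumes "Ck_cube p (Suc 0) g"
  shows "cube_lipschitz p (\<lambda>x. of_real (g x))"
proof -
  have "\<forall>j<p. \<exists>g'. (\<forall>x\<in>cube p. ((\<lambda>t. g (x(j := t))) has_real_derivative g' x) (at (x j) within {0..2 * pi}))
       \<and> continuous_on (cube p) g'"
    using assms by simp
  then obtain g' where g': "\<And>j x. j < p \<Longrightarrow> x \<in> cube p \<Longrightarrow>
      ((\<lambda>t. g (x(j := t))) has_real_derivative g' j x) (at (x j) within {0..2 * pi})"
    and cont: "\<And>j. j < p \<Longrightarrow> continuous_on (cube p) (g' j)"
    by metis
  have "\<exists>B\<ge>0. \<forall>x\<in>cube p. \<bar>g' j x\<bar> \<le> B" if "j < p" for j
  proof -
    have "bounded (g' j ` cube p)"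
      using compact_imp_bounded[OF compact_continuous_image[OF cont[OF that] compact_cube]] .
    then obtain B where B: "\<forall>x\<in>cube p. \<bar>g' j x\<bar> \<le> B" by (auto simp: bounded_iff)
    moreover have "0 \<le> B" using B zero_in_cube[of p] by fastforce
    ultimately show ?thesis by blast
  qed
  then obtain B where B0: "\<And>j. j < p \<Longrightarrow> 0 \<le> B j"
    and B: "\<And>j x. j < p \<Longrightarrow> x \<in> cube p \<Longrightarrow> \<bar>g' j x\<bar> \<le> B j" by metis
  have "\<bar>g x - g y\<bar> \<le> (\<Sum>j<p. B j) * \<delta>"
    if x: "x \<in> cube p" and y: "y \<in> cube p" and d: "\<And>j. j < p \<Longrightarrow> \<bar>x j - y j\<bar> \<le> \<delta>" for x y \<delta>
  proof -
    \<comment> \<open>The \<open>m\<close>-th point of the walk: the first \<open>m\<close>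
      coordinates are already those of \<open>y\<close>.\<close>
    define z where "z = (\<lambda>m j. if j < m then y j else x j)"
    have zc: "(z m)(j := t) \<in> cube p" if "j < p" "t \<in> {0..2 * pi}" for m j t
      using x y that by (auto simp: cube_def z_def)
    have "m \<le> p \<Longrightarrow> \<bar>g x - g (z m)\<bar> \<le> (\<Sum>j<m. B j) * \<delta>" for m
    proof (induction m)
      case 0
      have "z 0 = x" by (simp add: z_def)
      then show ?case by simp
    next
      case (Suc m)
      then have m: "m < p" by simp
      have "norm (g ((z m)(m := x m)) - g ((z m)(m := y m))) \<le> B m * norm (x m - y m)"
      proof (rule field_differentiable_bound[where S = "{0..2 * pi}" and f' = "\<lambda>t. g' m ((z m)(m := t))"])
        fix t assume t: "t \<in> {0..2 * pi}"
        show "((\<lambda>t. g ((z m)(m := t))) has_real_derivative g' m ((z m)(m := t))) (at t within {0..2 * pi})"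
          using g'[OF m zc[OF m t, of m]] by simp
        show "norm (g' m ((z m)(m := t))) \<le> B m" using B[OF m zc[OF m t]] by simp
      qed (use x y m in \<open>auto simp: cube_def\<close>)
      moreover have "(z m)(m := x m) = z m" "(z m)(m := y m) = z (Suc m)"
        by (auto simp: z_def)
      ultimately have "\<bar>g (z m) - g (z (Suc m))\<bar> \<le> B m * \<bar>x m - y m\<bar>" by simp
      also have "\<dots> \<le> B m * \<delta>" using d[OF m] B0[OF m] by (rule mult_left_mono)
      finally show ?case using Suc m by (simp add: distrib_right)
    qed
    from this[of p] have "\<bar>g x - g (z p)\<bar> \<le> (\<Sum>j<p. B j) * \<delta>" by simp
    moreover have "z p = y" using x y by (auto simp: z_def cube_def fun_eq_iff)
    ultimately show ?thesis by simp
  qed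
  moreover have "0 \<le> (\<Sum>j<p. B j)" using B0 by (intro sum_nonneg) auto
  ultimately show ?thesis unfolding cube_lipschitz_def of_real_diff[symmetric] norm_of_real
    by blast
qed

lemma cube_lipschitz_const: "cube_lipschitz p (\<lambda>_. c)"
  unfolding cube_lipschitz_def by (rule exI[of _ 0]) simp

lemma cube_lipschitz_cnj: "cube_lipschitz p f \<Longrightarrow> cube_lipschitz p (\<lambda>x. cnj (f x))"
  unfolding cube_lipschitz_def complex_cnj_diff[symmetric] complex_mod_cnj .

lemma cube_lipschitz_add:
  assumes "cube_lipschitz p f" "cube_lipschitz p g"
  shows "cube_lipschitz p (\<lambda>x. f x + g x)"
proof -
  obtain L where L: "L \<ge> 0" "\<And>x y \<delta>. x \<in> cube p \<Longrightarrow> y \<in> cube p \<Longrightarrow> \<delta> \<ge> 0 \<Longrightarrow>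
      (\<forall>j<p. \<bar>x j - y j\<bar> \<le> \<delta>) \<Longrightarrow> cmod (f x - f y) \<le> L * \<delta>"
    using assms(1) unfolding cube_lipschitz_def by blast
  obtain M where M: "M \<ge> 0" "\<And>x y \<delta>. x \<in> cube p \<Longrightarrow> y \<in> cube p \<Longrightarrow> \<delta> \<ge> 0 \<Longrightarrow>
      (\<forall>j<p. \<bar>x j - y j\<bar> \<le> \<delta>) \<Longrightarrow> cmod (g x - g y) \<le> M * \<delta>"
    using assms(2) unfolding cube_lipschitz_def by blast
  have "cmod (f x + g x - (f y + g y)) \<le> (L + M) * \<delta>"
    if "x \<in> cube p" "y \<in> cube p" "\<delta> \<ge> 0" "\<forall>j<p. \<bar>x j - y j\<bar> \<le> \<delta>" for x y \<delta>
  proof -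
    have "cmod (f x + g x - (f y + g y)) \<le> cmod (f x - f y) + cmod (g x - g y)"
      by (metis add_diff_add norm_triangle_ineq)
    then show ?thesis using L(2)[OF that] M(2)[OF that] by (simp add: distrib_right)
  qed
  then show ?thesis unfolding cube_lipschitz_def using L(1) M(1)
    by (intro exI[of _ "L + M"]) simp
qed

lemma cube_lipschitz_bounded:
  assumes "cube_lipschitz p f"
  obtains B where "B \<ge> 0" "\<And>x. x \<in> cube p \<Longrightarrow> cmod (f x) \<le> B"
proof -
  obtain L where L: "L \<ge> 0" "\<And>x y \<delta>. x \<in> cube p \<Longrightarrow> y \<in> cube p \<Longrightarrow> \<delta> \<ge> 0 \<Longrightarrow>
      (\<forall>j<p. \<bar>x j - y j\<bar> \<le> \<delta>) \<Longrightarrow> cmod (f x - f y) \<le> L * \<delta>"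
    using assms(1) unfolding cube_lipschitz_def by blast
  have "cmod (f x) \<le> cmod (f (\<lambda>_. 0)) + L * (2 * pi)" if "x \<in> cube p" for x
  proof -
    have "cmod (f x - f (\<lambda>_. 0)) \<le> L * (2 * pi)"
      using cube_diff_bound[OF that zero_in_cube] by (intro L(2) that zero_in_cube) auto
    then show ?thesis using norm_triangle_sub[of "f x" "f (\<lambda>_. 0)"] by linarith
  qed
  then show ?thesis using that[of "cmod (f (\<lambda>_. 0)) + L * (2 * pi)"] L(1) by simp
qed

lemma cube_lipschitz_mult:
  assumes f: "cube_lipschitz p f" and g: "cube_lipschitz p g"
  shows "cube_lipschitz p (\<lambda>x. f x * g x)"
proof -
  obtain L where L: "L \<ge> 0" "\<And>x y \<delta>. x \<in> cube p \<Longrightarrow> y \<in> cube p \<Longrightarrow> \<delta> \<ge> 0 \<Longrightarrow>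
      (\<forall>j<p. \<bar>x j - y j\<bar> \<le> \<delta>) \<Longrightarrow> cmod (f x - f y) \<le> L * \<delta>"
    using f unfolding cube_lipschitz_def by blast
  obtain M where M: "M \<ge> 0" "\<And>x y \<delta>. x \<in> cube p \<Longrightarrow> y \<in> cube p \<Longrightarrow> \<delta> \<ge> 0 \<Longrightarrow>
      (\<forall>j<p. \<bar>x j - y j\<bar> \<le> \<delta>) \<Longrightarrow> cmod (g x - g y) \<le> M * \<delta>"
    using g unfolding cube_lipschitz_def by blast
  obtain A where A: "A \<ge> 0" "\<And>x. x \<in> cube p \<Longrightarrow> cmod (f x) \<le> A"
    using cube_lipschitz_bounded[OF f] by blast
  obtain B where B: "B \<ge> 0" "\<And>x. x \<in> cube p \<Longrightarrow> cmod (g x) \<le> B"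
    using cube_lipschitz_bounded[OF g] by blast
  have "cmod (f x * g x - f y * g y) \<le> (A * M + L * B) * \<delta>"
    if "x \<in> cube p" "y \<in> cube p" "\<delta> \<ge> 0" "\<forall>j<p. \<bar>x j - y j\<bar> \<le> \<delta>" for x y \<delta>
  proof -
    have "f x * g x - f y * g y = f x * (g x - g y) + (f x - f y) * g y" by (simp add: algebra_simps)
    then have "cmod (f x * g x - f y * g y) \<le> cmod (f x) * cmod (g x - g y) + cmod (f x - f y) * cmod (g y)"
      by (metis norm_mult norm_triangle_ineq)
    also have "\<dots> \<le> A * (M * \<delta>) + (L * \<delta>) * B"
      using L(2)[OF that] M(2)[OF that] A B that L(1) by (intro add_mono mult_mono) auto
    finally show ?thesis by (simp add: algebra_simps)
  qed
  then show ?thesis unfolding cube_lipschitz_def using L(1) M(1) A(1) B(1)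
    by (intro exI[of _ "A * M + L * B"]) simp
qed

lemma cube_lipschitz_sum:
  assumes "\<And>i. i \<in> I \<Longrightarrow> cube_lipschitz p (f i)"
  shows "cube_lipschitz p (\<lambda>x. \<Sum>i\<in>I. f i x)"
  using assms
  by (induction I rule: infinite_finite_induct) (auto intro: cube_lipschitz_const cube_lipschitz_add)

lemma smooth_cube_imp_lipschitz:
  assumes "smooth_cube p (\<lambda>x. Re (f x))" "smooth_cube p (\<lambda>x. Im (f x))"
  shows "cube_lipschitz p f"
proof -
  have "cube_lipschitz p (\<lambda>x. of_real (Re (f x)) + \<i> * of_real (Im (f x)))"
    using assms unfolding smooth_cube_def
    by (intro cube_lipschitz_add cube_lipschitz_mult cube_lipschitz_const Ck_cube_imp_lipschitz) blast+
  then show ?thesis by (simp only: complex_eq[symmetric])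
qed

lemma smooth_cube_imp_continuous:
  assumes "smooth_cube p (\<lambda>x. Re (f x))" "smooth_cube p (\<lambda>x. Im (f x))"
  shows "continuous_on (cube p) f"
proof -
  have "Ck_cube p 0 (\<lambda>x. Re (f x))" "Ck_cube p 0 (\<lambda>x. Im (f x))"
    using assms by (auto simp only: smooth_cube_def)
  then have "continuous_on (cube p) (\<lambda>x. Complex (Re (f x)) (Im (f x)))"
    by (intro continuous_on_Complex) simp_all
  then show ?thesis by simp
qed

section \<open>Counting grid points against cells\<close>

text \<open>The hypothesis \<open>lip\<close> says that wherever \<open>C y = g i x\<close>, the
  parameter \<open>y\<close> depends on \<open>x\<close> in a Lipschitz way. If every
  \<open>y\<close> were hit, sending each grid point to its circuit and the cell of its preimage
  would inject \<open>n ^ card J\<close> points into fewer cells.\<close>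

lemma exists_parameter_avoiding_images:
  fixes C :: "('j \<Rightarrow> real) \<Rightarrow> 'm" and g :: "'i \<Rightarrow> (nat \<Rightarrow> real) \<Rightarrow> 'm" and p :: "'i \<Rightarrow> nat"
  assumes J: "finite J" and G: "finite G" and p: "\<And>i. i \<in> G \<Longrightarrow> p i < card J"
    and lip: "\<And>i. i \<in> G \<Longrightarrow> \<exists>L\<ge>0. \<forall>x\<in>cube (p i). \<forall>x'\<in>cube (p i). \<forall>y \<in> J \<rightarrow> {0..1}. \<forall>y' \<in> J \<rightarrow> {0..1}. \<forall>\<delta>\<ge>0.
       C y = g i x \<longrightarrow> C y' = g i x' \<longrightarrow> (\<forall>k<p i. \<bar>x k - x' k\<bar> \<le> \<delta>) \<longrightarrow> (\<forall>j\<in>J. \<bar>y j - y' j\<bar> \<le> L * \<delta>)"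
  shows "\<exists>y \<in> J \<rightarrow> {0..1}. \<forall>i\<in>G. C y \<notin> g i ` cube (p i)"
proof (cases "G = {}")
  case True
  then show ?thesis by (intro bexI[of _ "\<lambda>_. 0"]) auto
next
  case False
  \<comment> \<open>Makes \<open>card J - 1\<close>, the exponent in the final count, a genuine
    predecessor.\<close>
  then have d: "0 < card J" using p by fastforce
  show ?thesis
  proof (rule ccontr)
    assume "\<not> ?thesis"
    then have "\<forall>y \<in> J \<rightarrow> {0..1}. \<exists>i x. i \<in> G \<and> x \<in> cube (p i) \<and> C y = g i x" by blast
    then obtain \<iota> \<xi> where \<iota>: "\<And>y. y \<in> J \<rightarrow> {0..1} \<Longrightarrow> \<iota> y \<in> G"
      and \<xi>: "\<And>y. y \<in> J \<rightarrow> {0..1} \<Longrightarrow> \<xi> y \<in> cube (p (\<iota> y))"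
      and eq: "\<And>y. y \<in> J \<rightarrow> {0..1} \<Longrightarrow> C y = g (\<iota> y) (\<xi> y)" by metis
    obtain L where L0: "\<And>i. i \<in> G \<Longrightarrow> 0 \<le> L i"
      and L: "\<And>i x x' y y' \<delta> j. i \<in> G \<Longrightarrow> x \<in> cube (p i) \<Longrightarrow> x' \<in> cube (p i) \<Longrightarrow> y \<in> J \<rightarrow> {0..1} \<Longrightarrow>
        y' \<in> J \<rightarrow> {0..1} \<Longrightarrow> \<delta> \<ge> 0 \<Longrightarrow> C y = g i x \<Longrightarrow> C y' = g i x' \<Longrightarrow>
        (\<forall>k<p i. \<bar>x k - x' k\<bar> \<le> \<delta>) \<Longrightarrow> j \<in> J \<Longrightarrow> \<bar>y j - y' j\<bar> \<le> L i * \<delta>"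
      using lip by metis
    \<comment> \<open>Cells have side \<open>1 / ((L i + 1) * n)\<close>, so fewer than
      \<open>M i * n\<close> of them are met along an edge of length \<open>2 * pi\<close>, plus the
      one of index 0. The 1 added to \<open>L i\<close> covers \<open>L i = 0\<close> and later
      gives a strict inequality.\<close>
    define M where "M = (\<lambda>i. Suc (nat \<lceil>2 * pi * (L i + 1)\<rceil>))"
    \<comment> \<open>One more than the sum of the cell constants: the cells number at most
      \<open>(n - 1) * n ^ (card J - 1)\<close>, which is less than
      \<open>n ^ card J\<close>.\<close>
    define n where "n = Suc (\<Sum>i\<in>G. M i ^ p i)"
    have n: "0 < n" by (simp add: n_def)
    define y :: "('j \<Rightarrow> nat) \<Rightarrow> 'j \<Rightarrow> real" where "y = (\<lambda>f j. real (f j) / real n)"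
    define F where "F = Pi\<^sub>E J (\<lambda>_. {..<n})"
    define cell where "cell = (\<lambda>f. (\<iota> (y f), \<lambda>k\<in>{..<p (\<iota> (y f))}. nat \<lfloor>\<xi> (y f) k * (L (\<iota> (y f)) + 1) * real n\<rfloor>))"
    define T where "T = Sigma G (\<lambda>i. Pi\<^sub>E {..<p i} (\<lambda>_. {..<M i * n}))"
    have yU: "y f \<in> J \<rightarrow> {0..1}" if "f \<in> F" for f
    proof
      fix j assume "j \<in> J"
      then have "f j < n" using that by (auto simp: F_def)
      then show "y f j \<in> {0..1}" by (simp add: y_def)
    qed
    have finT: "finite T" unfolding T_def using G by (intro finite_SigmaI finite_PiE) auto
    have sub: "cell ` F \<subseteq> T"
    proof
      fix c assume "c \<in> cell ` F"
      then obtain f where f: "f \<in> F" "c = cell f" by blast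
      define i where "i = \<iota> (y f)"
      have i: "i \<in> G" and x: "\<xi> (y f) \<in> cube (p i)" using \<iota> \<xi> yU[OF f(1)] by (auto simp: i_def)
      have "nat \<lfloor>\<xi> (y f) k * (L i + 1) * real n\<rfloor> < M i * n" if k: "k < p i" for k
      proof -
        have "\<xi> (y f) k * (L i + 1) * real n \<le> 2 * pi * (L i + 1) * real n"
          using x k L0[OF i] by (intro mult_right_mono) (auto simp: cube_def)
        also have "\<dots> < real (M i) * real n"
          using n unfolding M_def by (intro mult_strict_right_mono) (linarith, simp)
        finally have "\<xi> (y f) k * (L i + 1) * real n < real (M i * n)" by simp
        moreover have "0 \<le> \<xi> (y f) k * (L i + 1) * real n"
          using x k L0[OF i] by (auto simp: cube_def)
        ultimately show ?thesis by linarith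
      qed
      then show "c \<in> T" using i unfolding f(2) cell_def T_def i_def[symmetric] by auto
    qed
    have inj: "inj_on cell F"
    proof (rule inj_onI)
      fix f f' assume f: "f \<in> F" and f': "f' \<in> F" and c: "cell f = cell f'"
      define i where "i = \<iota> (y f)"
      have i': "\<iota> (y f') = i" using c by (simp add: cell_def i_def)
      have i: "i \<in> G" and x: "\<xi> (y f) \<in> cube (p i)" using \<iota> \<xi> yU[OF f] by (auto simp: i_def)
      have x': "\<xi> (y f') \<in> cube (p i)" using \<xi>[OF yU[OF f']] i' by simp
      have pos: "0 < (L i + 1) * real n" using L0[OF i] n by simp
      define \<delta> where "\<delta> = 1 / ((L i + 1) * real n)"
      have close: "\<forall>k<p i. \<bar>\<xi> (y f) k - \<xi> (y f') k\<bar> \<le> \<delta>"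
      proof (intro allI impI)
        fix k assume k: "k < p i"
        define a where "a = \<xi> (y f) k * ((L i + 1) * real n)"
        define b where "b = \<xi> (y f') k * ((L i + 1) * real n)"
        have "a \<ge> 0" "b \<ge> 0" using x x' k pos by (auto simp: a_def b_def cube_def)
        moreover have "nat \<lfloor>a\<rfloor> = nat \<lfloor>b\<rfloor>"
        proof -
          have "snd (cell f) k = snd (cell f') k" using c by simp
          then show ?thesis using k i' by (simp add: cell_def i_def[symmetric] a_def b_def mult.assoc)
        qed
        ultimately have "\<bar>a - b\<bar> \<le> 1" by linarith
        moreover have "\<bar>a - b\<bar> = \<bar>\<xi> (y f) k - \<xi> (y f') k\<bar> * ((L i + 1) * real n)"
          using abs_of_pos[OF pos] by (simp only: a_def b_def abs_mult flip: left_diff_distrib)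
        ultimately have "\<bar>\<xi> (y f) k - \<xi> (y f') k\<bar> * ((L i + 1) * real n) \<le> 1" by simp
        then show "\<bar>\<xi> (y f) k - \<xi> (y f') k\<bar> \<le> \<delta>"
          unfolding \<delta>_def using pos_le_divide_eq[OF pos] by blast
      qed
      have "f j = f' j" if j: "j \<in> J" for j
      proof -
        \<comment> \<open>A common cell forces a distance of at most
          \<open>L i / ((L i + 1) * n)\<close>, strictly below the grid spacing
          \<open>1 / n\<close>.\<close>
        have "\<bar>y f j - y f' j\<bar> \<le> L i * \<delta>"
          using eq[OF yU[OF f]] eq[OF yU[OF f']] i' pos
          by (intro L[OF i x x' yU[OF f] yU[OF f'] _ _ _ close j]) (auto simp: i_def \<delta>_def)
        also have "\<dots> < 1 / real n"
          using L0[OF i] n by (simp add: \<delta>_def divide_simps)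
        finally have "\<bar>y f j - y f' j\<bar> < 1 / real n" .
        moreover have "y f j - y f' j = (real (f j) - real (f' j)) / real n"
          by (simp add: y_def diff_divide_distrib)
        ultimately have "\<bar>real (f j) - real (f' j)\<bar> / real n < 1 / real n" by (simp add: abs_divide)
        then have "\<bar>real (f j) - real (f' j)\<bar> < 1" using n by (simp add: divide_less_cancel)
        then show ?thesis by linarith
      qed
      then show "f = f'" using f f' unfolding F_def by (intro PiE_ext) auto
    qed
    have "n ^ card J = card F" using J by (simp add: F_def card_PiE)
    also have "\<dots> \<le> card T" using card_inj_on_le[OF inj sub finT] .
    also have "card T = (\<Sum>i\<in>G. (M i * n) ^ p i)"
      unfolding T_def using G by (subst card_SigmaI) (auto simp: card_PiE intro!: finite_PiE)
    also have "\<dots> \<le> (\<Sum>i\<in>G. M i ^ p i * n ^ (card J - 1))"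
    proof (rule sum_mono)
      fix i assume "i \<in> G"
      then have "p i \<le> card J - 1" using p by fastforce
      then have "n ^ p i \<le> n ^ (card J - 1)" using n by (intro power_increasing) auto
      then show "(M i * n) ^ p i \<le> M i ^ p i * n ^ (card J - 1)" by (simp add: power_mult_distrib)
    qed
    also have "\<dots> = (n - 1) * n ^ (card J - 1)" by (simp add: n_def sum_distrib_right)
    also have "\<dots> < n * n ^ (card J - 1)" using n by simp
    also have "\<dots> = n ^ card J" using power_minus_mult[OF d, of n] by (simp add: mult.commute)
    finally show False by simp
  qed
qed

section \<open>A family of extreme Choi states\<close>

lemma index_less: "a < m \<Longrightarrow> b < n \<Longrightarrow> a * n + b < m * (n::nat)"
proof -
  assume "a < m" "b < n"
  then have "a * n + b < Suc a * n" by simp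
  also have "\<dots> \<le> m * n" using \<open>a < m\<close> by (intro mult_le_mono1) simp
  finally show ?thesis .
qed

text \<open>The multiples of \<open>dB\<close> are the row indices with \<open>b = 0\<close>; this
  isolates their contribution.\<close>

lemma sum_multiples:
  fixes f :: "nat \<Rightarrow> 'a :: comm_monoid_add"
  assumes "0 < n"
  shows "(\<Sum>s<m * n. if s mod n = 0 then f s else 0) = (\<Sum>k<m. f (k * n))"
proof -
  have "(\<Sum>s<m * n. if s mod n = 0 then f s else 0) = sum f {s \<in> {..<m * n}. s mod n = 0}"
    by (rule sum.inter_filter[symmetric]) simp
  also have "\<dots> = (\<Sum>k<m. f (k * n))"
    by (rule sum.reindex_bij_witness[of _ "\<lambda>k. k * n" "\<lambda>s. s div n"])
      (use assms in \<open>auto simp: less_mult_imp_div_less\<close>)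
  finally show ?thesis .
qed

lemma choi_set_iff:
  "C \<in> choi_set dA dB \<longleftrightarrow> C \<in> carrier_mat (dA * dB) (dA * dB) \<and> psd C \<and>
    (\<forall>a<dA. \<forall>a'<dA. (\<Sum>b<dB. C $$ (a * dB + b, a' * dB + b)) = (if a = a' then 1 / of_nat dA else 0))"
  by (auto simp: choi_set_def ptrace_B_def mat_eq_iff)

text \<open>Entry \<open>(r, s)\<close> of \<open>W Q W^*\<close>, where \<open>W\<close> has
  \<open>d\<close> columns.\<close>

definition sandwich :: "nat \<Rightarrow> (nat \<Rightarrow> nat \<Rightarrow> complex) \<Rightarrow> (nat \<Rightarrow> nat \<Rightarrow> complex) \<Rightarrow> nat \<Rightarrow> nat \<Rightarrow> complex" where
  "sandwich d W Q r s = (\<Sum>k<d. \<Sum>l<d. W r k * Q k l * cnj (W s l))"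

lemma cnj_sandwich: "cnj (sandwich d W Q r s) = sandwich d W (\<lambda>k l. cnj (Q l k)) s r"
  unfolding sandwich_def cnj_sum by (subst sum.swap) (simp add: mult_ac)

lemma sandwich_cong:
  "(\<And>k l. k < d \<Longrightarrow> l < d \<Longrightarrow> Q k l = Q' k l) \<Longrightarrow> sandwich d W Q r s = sandwich d W Q' r s"
  unfolding sandwich_def by (intro sum.cong) auto

text \<open>Fixing the block \<open>b = 0\<close> to the identity removes the ambiguity of replacing
  \<open>W\<close> by \<open>W S\<close> for an invertible \<open>S\<close> and compensating in the
  middle factor, so that \<open>W\<close> can be recovered from the state.\<close>

locale frame =
  fixes dA dB :: nat and W :: "nat \<Rightarrow> nat \<Rightarrow> complex"
  assumes dA: "0 < dA" and dB: "0 < dB"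
    and W_top: "\<And>a k. a < dA \<Longrightarrow> k < dA \<Longrightarrow> W (a * dB) k = (if a = k then 1 else 0)"
    and W_small: "\<And>r k. r < dA * dB \<Longrightarrow> r mod dB \<noteq> 0 \<Longrightarrow> k < dA \<Longrightarrow>
      cmod (W r k) \<le> 1 / (2 * real dA ^ 2 * real dB)"
begin

lemma sandwich_top_right:
  assumes "a < dA"
  shows "sandwich dA W Q r (a * dB) = (\<Sum>k<dA. W r k * Q k a)"
  unfolding sandwich_def using assms
  by (intro sum.cong refl) (simp add: W_top if_distrib[of cnj] mult_delta_right cong: if_cong)

lemma sandwich_top:
  assumes "a < dA" "a' < dA"
  shows "sandwich dA W Q (a * dB) (a' * dB) = Q a a'"
  using assms by (simp add: sandwich_top_right W_top mult_delta_left)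

text \<open>Every column is a combination of the columns with \<open>b = 0\<close>, with
  coefficients read off \<open>W\<close>. Both the rank and the null vectors of the state come from
  this relation.\<close>

lemma sandwich_eq_top_sum:
  "sandwich dA W Q r s = (\<Sum>l<dA. sandwich dA W Q r (l * dB) * cnj (W s l))"
proof -
  have "sandwich dA W Q r s = (\<Sum>l<dA. \<Sum>k<dA. W r k * Q k l * cnj (W s l))"
    unfolding sandwich_def by (rule sum.swap)
  then show ?thesis by (simp add: sandwich_top_right sum_distrib_right)
qed

lemma W_le_1: "r < dA * dB \<Longrightarrow> k < dA \<Longrightarrow> cmod (W r k) \<le> 1"
proof (cases "r mod dB = 0")
  case True
  assume "r < dA * dB" "k < dA"
  moreover from this have "r div dB < dA" by (simp add: less_mult_imp_div_less)
  ultimately show ?thesis using W_top[of "r div dB" k] True by (auto simp: mult.commute)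
next
  case False
  assume "r < dA * dB" "k < dA"
  then have "cmod (W r k) \<le> 1 / (2 * real dA ^ 2 * real dB)" using W_small False by blast
  also have "\<dots> \<le> 1"
  proof -
    have "1 \<le> dA\<^sup>2 * dB" using dA dB by simp
    then have "1 \<le> real dA ^ 2 * real dB" by (metis of_nat_1 of_nat_le_iff of_nat_mult of_nat_power)
    then show ?thesis by (subst divide_le_eq_1_pos) linarith+
  qed
  finally show ?thesis .
qed

text \<open>Matrix, on index pairs, of the map sending \<open>Q\<close> to the sum of
  \<open>W_b Q W_b^*\<close> over \<open>b\<close> from 1 on.\<close>

definition kern :: "nat \<times> nat \<Rightarrow> nat \<times> nat \<Rightarrow> complex" where
  "kern i j = (\<Sum>b\<in>{1..<dB}. W (fst i * dB + b) (fst j) * cnj (W (snd i * dB + b) (snd j)))"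

text \<open>There are \<open>dA^2\<close> entries, each a sum of fewer than \<open>dB\<close> terms
  of size at most \<open>\<epsilon>^2\<close>. The total is at most
  \<open>1 / (4 dA^2 dB)\<close>.\<close>

lemma kern_row_sum:
  assumes "i \<in> {..<dA} \<times> {..<dA}"
  shows "(\<Sum>j\<in>{..<dA} \<times> {..<dA}. cmod (kern i j)) \<le> 1 / (4 * real dA)"
proof -
  define \<epsilon> where "\<epsilon> = 1 / (2 * real dA ^ 2 * real dB)"
  have e0: "\<epsilon> \<ge> 0" by (simp add: \<epsilon>_def)
  have "cmod (kern i j) \<le> real dB * \<epsilon>\<^sup>2" if j: "j \<in> {..<dA} \<times> {..<dA}" for j
  proof -
    have "cmod (W (a * dB + b) k) \<le> \<epsilon>" if "a < dA" "b \<in> {1..<dB}" "k < dA" for a b k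
      unfolding \<epsilon>_def using that by (intro W_small) (auto intro: index_less)
    then have "cmod (kern i j) \<le> (\<Sum>b\<in>{1..<dB}. \<epsilon>\<^sup>2)"
      unfolding kern_def power2_eq_square using assms j e0
      by (intro sum_norm_le) (auto simp: norm_mult intro!: mult_mono)
    also have "\<dots> \<le> real dB * \<epsilon>\<^sup>2" by (simp add: mult_right_mono)
    finally show ?thesis .
  qed
  then have "(\<Sum>j\<in>{..<dA} \<times> {..<dA}. cmod (kern i j)) \<le> (\<Sum>j\<in>{..<dA} \<times> {..<dA}. real dB * \<epsilon>\<^sup>2)"
    by (rule sum_mono)
  also have "\<dots> = (real dA * real dA) * (real dB * \<epsilon>\<^sup>2)" by simp
  also have "\<dots> = 1 / (4 * real dA * (real dA * real dB))"
    using dA dB by (simp add: \<epsilon>_def power2_eq_square field_simps)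
  also have "\<dots> \<le> 1 / (4 * real dA * 1)"
  proof -
    have "1 \<le> dA * dB" using dA dB by simp
    then have "1 \<le> real dA * real dB" by (metis of_nat_1 of_nat_le_iff of_nat_mult)
    then show ?thesis using dA by (intro divide_left_mono mult_left_mono) auto
  qed
  finally show ?thesis by simp
qed

lemma kern_contracts:
  assumes "i \<in> {..<dA} \<times> {..<dA}"
  shows "(\<Sum>j\<in>{..<dA} \<times> {..<dA}. cmod (kern i j)) \<le> 1 / 2"
proof -
  have "1 / (4 * real dA) \<le> 1 / 2" using dA by (simp add: divide_simps)
  then show ?thesis using kern_row_sum[OF assms] by linarith
qed

text \<open>The block \<open>b = 0\<close> returns \<open>Q\<close> itself, so the partial trace
  acts as the identity plus \<open>kern\<close>.\<close>

lemma partial_trace_sandwich: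
  assumes "a < dA" "a' < dA"
  shows "(\<Sum>b<dB. sandwich dA W Q (a * dB + b) (a' * dB + b)) =
    Q a a' + (\<Sum>j\<in>{..<dA} \<times> {..<dA}. kern (a, a') j * Q (fst j) (snd j))"
proof -
  have "{..<dB} = insert 0 {1..<dB}" using dB by auto
  then have "(\<Sum>b<dB. sandwich dA W Q (a * dB + b) (a' * dB + b)) =
      Q a a' + (\<Sum>b\<in>{1..<dB}. sandwich dA W Q (a * dB + b) (a' * dB + b))"
    using sandwich_top[OF assms] by simp
  also have "(\<Sum>b\<in>{1..<dB}. sandwich dA W Q (a * dB + b) (a' * dB + b)) =
      (\<Sum>b\<in>{1..<dB}. \<Sum>j\<in>{..<dA} \<times> {..<dA}. W (a * dB + b) (fst j) * Q (fst j) (snd j) * cnj (W (a' * dB + b) (snd j)))"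
    by (simp add: sandwich_def sum.cartesian_product case_prod_unfold)
  also have "\<dots> = (\<Sum>j\<in>{..<dA} \<times> {..<dA}. kern (a, a') j * Q (fst j) (snd j))"
    by (subst sum.swap) (simp add: kern_def sum_distrib_right sum_distrib_left mult_ac)
  finally show ?thesis .
qed

text \<open>The difference solves the homogeneous contractive system. For the Kraus operators given
  by the columns of \<open>W\<close>, this injectivity is the linear independence in Choi's
  criterion for extreme channels.\<close>

lemma partial_trace_inj:
  assumes eq: "\<And>a a'. a < dA \<Longrightarrow> a' < dA \<Longrightarrow>
      (\<Sum>b<dB. sandwich dA W P (a * dB + b) (a' * dB + b)) =
      (\<Sum>b<dB. sandwich dA W Q (a * dB + b) (a' * dB + b))"
    and "a < dA" "a' < dA"
  shows "P a a' = Q a a'"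
proof -
  define x where "x = (\<lambda>i. P (fst i) (snd i) - Q (fst i) (snd i))"
  have "cmod (x (a, a')) \<le> 2 * 0"
  proof (rule contraction_system_bound[where I = "{..<dA} \<times> {..<dA}" and K = kern and x = x])
    fix i :: "nat \<times> nat" assume i: "i \<in> {..<dA} \<times> {..<dA}"
    show "cmod (x i + (\<Sum>j\<in>{..<dA} \<times> {..<dA}. kern i j * x j)) \<le> 0"
    proof -
      have f: "fst i < dA" "snd i < dA" using i by auto
      have "x i + (\<Sum>j\<in>{..<dA} \<times> {..<dA}. kern i j * x j) =
        (P (fst i) (snd i) + (\<Sum>j\<in>{..<dA} \<times> {..<dA}. kern i j * P (fst j) (snd j))) -
        (Q (fst i) (snd i) + (\<Sum>j\<in>{..<dA} \<times> {..<dA}. kern i j * Q (fst j) (snd j)))"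
        by (simp add: x_def right_diff_distrib sum_subtractf)
      also have "\<dots> = 0"
        using eq[OF f] unfolding partial_trace_sandwich[OF f] by simp
      finally show ?thesis by simp
    qed
  qed (use kern_contracts assms in auto)
  then show ?thesis by (simp add: x_def)
qed

section \<open>The middle factor P and its inverse\<close>

text \<open>The matrix P of the overview. The condition concerns only indices below
  \<open>dA\<close>, and there \<open>partial_trace_inj\<close> makes it unique.\<close>

definition weight :: "nat \<Rightarrow> nat \<Rightarrow> complex" where
  "weight = (SOME P. \<forall>a<dA. \<forall>a'<dA.
     (\<Sum>b<dB. sandwich dA W P (a * dB + b) (a' * dB + b)) = (if a = a' then 1 / of_nat dA else 0))"

lemma weight_trace:
  assumes "a < dA" "a' < dA"
  shows "(\<Sum>b<dB. sandwich dA W weight (a * dB + b) (a' * dB + b)) = (if a = a' then 1 / of_nat dA else 0)"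
proof -
  obtain x where x: "\<forall>i\<in>{..<dA} \<times> {..<dA}. x i + (\<Sum>j\<in>{..<dA} \<times> {..<dA}. kern i j * x j) =
      (if fst i = snd i then 1 / of_nat dA else 0)"
    using contraction_system_solution[of "{..<dA} \<times> {..<dA}" kern
        "\<lambda>i. if fst i = snd i then 1 / of_nat dA else 0", OF _ kern_contracts] by blast
  have "\<exists>P. \<forall>a<dA. \<forall>a'<dA.
     (\<Sum>b<dB. sandwich dA W P (a * dB + b) (a' * dB + b)) = (if a = a' then 1 / of_nat dA else 0)"
  proof (intro exI[of _ "\<lambda>a a'. x (a, a')"] allI impI)
    fix a a' assume a: "a < dA" "a' < dA"
    show "(\<Sum>b<dB. sandwich dA W (\<lambda>a a'. x (a, a')) (a * dB + b) (a' * dB + b)) =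
        (if a = a' then 1 / of_nat dA else 0)"
      unfolding partial_trace_sandwich[OF a] using x[rule_format, of "(a, a')"] a by simp
  qed
  from someI_ex[OF this] show ?thesis unfolding weight_def using assms by blast
qed

text \<open>The conjugate transpose solves the same system, as the right-hand side is Hermitian;
  uniqueness concludes.\<close>

lemma weight_hermitian: "a < dA \<Longrightarrow> a' < dA \<Longrightarrow> weight a a' = cnj (weight a' a)"
proof (rule partial_trace_inj[of weight "\<lambda>a a'. cnj (weight a' a)"])
  fix a a' assume a: "a < dA" "a' < dA"
  show "(\<Sum>b<dB. sandwich dA W weight (a * dB + b) (a' * dB + b)) =
      (\<Sum>b<dB. sandwich dA W (\<lambda>a a'. cnj (weight a' a)) (a * dB + b) (a' * dB + b))"
    unfolding cnj_sandwich[symmetric] cnj_sum[symmetric] using a by (simp add: weight_trace)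
qed

text \<open>The crude bound \<open>2 / dA\<close> on the entries, inserted into the
  \<open>kern\<close> term with row sums at most \<open>1 / (4 dA)\<close>, bounds the deviation
  from \<open>I / dA\<close>.\<close>

lemma weight_near:
  assumes a: "a < dA" "a' < dA"
  shows "cmod (weight a a' - (if a = a' then 1 / of_nat dA else 0)) \<le> 1 / (2 * real dA ^ 2)"
proof -
  let ?I = "{..<dA} \<times> {..<dA}"
  have le: "cmod (weight (fst i) (snd i)) \<le> 2 * (1 / real dA)" if "i \<in> ?I" for i
  proof (rule contraction_system_bound[where I = ?I and K = kern and x = "\<lambda>i. weight (fst i) (snd i)"])
    fix i :: "nat \<times> nat" assume i: "i \<in> ?I"
    then have "fst i < dA" "snd i < dA" by auto
    from partial_trace_sandwich[OF this, of weight] weight_trace[OF this]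
    have "weight (fst i) (snd i) + (\<Sum>j\<in>?I. kern i j * weight (fst j) (snd j)) =
      (if fst i = snd i then 1 / of_nat dA else 0)" by simp
    then show "cmod (weight (fst i) (snd i) + (\<Sum>j\<in>?I. kern i j * weight (fst j) (snd j))) \<le> 1 / real dA"
      by (simp add: norm_divide)
  qed (use kern_contracts that in auto)
  have "weight a a' + (\<Sum>j\<in>?I. kern (a, a') j * weight (fst j) (snd j)) = (if a = a' then 1 / of_nat dA else 0)"
    using partial_trace_sandwich[OF a, of weight] weight_trace[OF a] by simp
  then have "weight a a' - (if a = a' then 1 / of_nat dA else 0) = - (\<Sum>j\<in>?I. kern (a, a') j * weight (fst j) (snd j))"
    by (simp add: algebra_simps)
  then have "cmod (weight a a' - (if a = a' then 1 / of_nat dA else 0)) =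
      cmod (\<Sum>j\<in>?I. kern (a, a') j * weight (fst j) (snd j))" by simp
  also have "\<dots> \<le> (\<Sum>j\<in>?I. cmod (kern (a, a') j) * (2 * (1 / real dA)))"
    by (intro sum_norm_le order_trans[OF eq_refl[OF norm_mult]] mult_left_mono le) auto
  also have "\<dots> \<le> 1 / (4 * real dA) * (2 * (1 / real dA))"
    unfolding sum_distrib_right[symmetric] using a by (intro mult_right_mono kern_row_sum) auto
  also have "\<dots> = 1 / (2 * real dA ^ 2)" by (simp add: power2_eq_square)
  finally show ?thesis .
qed

text \<open>In \<open>weight = I / dA + R\<close>, the identity part contributes
  \<open>S / dA\<close> to the form, and the inequality between geometric and arithmetic mean bounds
  the contribution of \<open>R\<close> by half of that.\<close>

lemma weight_nonneg: "0 \<le> Re (\<Sum>k<dA. \<Sum>l<dA. cnj (z k) * weight k l * z l)"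
proof -
  define R where "R = (\<lambda>k l. weight k l - (if k = l then 1 / of_nat dA else 0))"
  define S where "S = (\<Sum>k<dA. (cmod (z k))\<^sup>2)"
  have "(\<Sum>k<dA. \<Sum>l<dA. cnj (z k) * weight k l * z l) =
      (\<Sum>k<dA. \<Sum>l<dA. (if k = l then cnj (z k) * z l / of_nat dA else 0) + cnj (z k) * R k l * z l)"
    by (intro sum.cong refl) (simp add: R_def algebra_simps)
  also have "\<dots> = (\<Sum>k<dA. cnj (z k) * z k / of_nat dA) + (\<Sum>k<dA. \<Sum>l<dA. cnj (z k) * R k l * z l)"
    by (simp add: sum.distrib)
  also have "(\<Sum>k<dA. cnj (z k) * z k / of_nat dA) = of_real (S / real dA)"
    by (simp add: S_def sum_divide_distrib complex_norm_square mult.commute del: of_real_power)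
  finally have split: "Re (\<Sum>k<dA. \<Sum>l<dA. cnj (z k) * weight k l * z l) =
      S / real dA + Re (\<Sum>k<dA. \<Sum>l<dA. cnj (z k) * R k l * z l)" by simp
  have "cmod (\<Sum>k<dA. \<Sum>l<dA. cnj (z k) * R k l * z l) \<le>
      (\<Sum>k<dA. \<Sum>l<dA. ((cmod (z k))\<^sup>2 + (cmod (z l))\<^sup>2) / (4 * real dA ^ 2))"
  proof (intro sum_norm_le)
    fix k l assume "k \<in> {..<dA}" "l \<in> {..<dA}"
    then have R: "cmod (R k l) \<le> 1 / (2 * real dA ^ 2)" unfolding R_def by (intro weight_near) auto
    have "cmod (cnj (z k) * R k l * z l) = cmod (R k l) * (cmod (z k) * cmod (z l))"
      by (simp add: norm_mult)
    also have "\<dots> \<le> 1 / (2 * real dA ^ 2) * (((cmod (z k))\<^sup>2 + (cmod (z l))\<^sup>2) / 2)"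
      using sum_squares_bound[of "cmod (z k)" "cmod (z l)"] by (intro mult_mono R) auto
    finally show "cmod (cnj (z k) * R k l * z l) \<le> ((cmod (z k))\<^sup>2 + (cmod (z l))\<^sup>2) / (4 * real dA ^ 2)"
      by simp
  qed
  also have "\<dots> = (\<Sum>k<dA. \<Sum>l<dA. (cmod (z k))\<^sup>2 + (cmod (z l))\<^sup>2) / (4 * real dA ^ 2)"
    by (simp only: sum_divide_distrib)
  also have "(\<Sum>k<dA. \<Sum>l<dA. (cmod (z k))\<^sup>2 + (cmod (z l))\<^sup>2) = 2 * real dA * S"
    by (simp add: sum.distrib S_def sum_distrib_left mult.assoc)
  also have "2 * real dA * S / (4 * real dA ^ 2) = S / real dA / 2"
    using dA by (simp add: power2_eq_square)
  finally have "\<bar>Re (\<Sum>k<dA. \<Sum>l<dA. cnj (z k) * R k l * z l)\<bar> \<le> S / real dA / 2"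
    using abs_Re_le_cmod order_trans by blast
  moreover have "0 \<le> S / real dA" by (simp add: S_def sum_nonneg)
  moreover have "\<bar>x\<bar> \<le> a / 2 \<Longrightarrow> 0 \<le> a \<Longrightarrow> 0 \<le> a + x" for a x :: real by linarith
  ultimately show ?thesis unfolding split by blast
qed

text \<open>\<open>dA\<close> times the transpose of \<open>weight\<close> is the identity plus a
  matrix with row sums at most 1/2. With \<open>\<beta> = 0\<close> this is invertibility of
  \<open>weight\<close>.\<close>

lemma weight_inverse_bound:
  assumes x: "\<And>l. l < dA \<Longrightarrow> cmod (\<Sum>k<dA. x k * weight k l) \<le> \<beta>" and k: "k < dA"
  shows "cmod (x k) \<le> 2 * (real dA * \<beta>)"
proof -
  define K where "K = (\<lambda>l k. of_nat dA * (weight k l - (if k = l then 1 / of_nat dA else 0)))"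
  show ?thesis
  proof (rule contraction_system_bound[where I = "{..<dA}" and K = K and x = x])
    fix l assume l: "l \<in> {..<dA}"
    have "(\<Sum>k<dA. cmod (K l k)) \<le> (\<Sum>k<dA. real dA * (1 / (2 * real dA ^ 2)))"
    proof (intro sum_mono)
      fix k assume "k \<in> {..<dA}"
      then show "cmod (K l k) \<le> real dA * (1 / (2 * real dA ^ 2))"
        using l unfolding K_def norm_mult norm_of_nat by (intro mult_left_mono weight_near) auto
    qed
    also have "\<dots> = 1 / 2" using dA by (simp add: power2_eq_square)
    finally show "(\<Sum>k<dA. cmod (K l k)) \<le> 1 / 2" .
    have "x l + (\<Sum>k<dA. K l k * x k) = x l + (\<Sum>k<dA. of_nat dA * (x k * weight k l) - (if k = l then x k else 0))"
      using dA by (intro arg_cong[where f = "(+) (x l)"] sum.cong refl) (simp add: K_def algebra_simps)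
    also have "\<dots> = of_nat dA * (\<Sum>k<dA. x k * weight k l)"
      using l by (simp add: sum_subtractf sum_distrib_left)
    finally have "cmod (x l + (\<Sum>k<dA. K l k * x k)) = real dA * cmod (\<Sum>k<dA. x k * weight k l)"
      by (simp add: norm_mult)
    also have "\<dots> \<le> real dA * \<beta>" using x l by (intro mult_left_mono) auto
    finally show "cmod (x l + (\<Sum>k<dA. K l k * x k)) \<le> real dA * \<beta>" .
  qed (use k in auto)
qed

section \<open>The Choi state of a frame: membership, extremality, rank\<close>

definition state :: "complex mat" where
  "state = mat (dA * dB) (dA * dB) (\<lambda>(r, s). sandwich dA W weight r s)"

lemma state_carrier [simp]: "state \<in> carrier_mat (dA * dB) (dA * dB)"
  by (simp add: state_def)

lemma index_state: "r < dA * dB \<Longrightarrow> s < dA * dB \<Longrightarrow> state $$ (r, s) = sandwich dA W weight r s"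
  by (simp add: state_def)

lemma state_in_choi_set: "state \<in> choi_set dA dB"
proof -
  have "psd state"
    unfolding psd_iff[OF state_carrier]
  proof (intro conjI allI impI)
    fix i j assume "i < dA * dB" "j < dA * dB"
    then show "state $$ (i, j) = cnj (state $$ (j, i))"
      unfolding index_state cnj_sandwich by (simp add: index_state cnj_sandwich) (rule sandwich_cong, rule weight_hermitian)
  next
    fix v :: "nat \<Rightarrow> complex"
    \<comment> \<open>With \<open>z = W^* v\<close>, the form of \<open>state\<close> at
      \<open>v\<close> becomes the form of \<open>weight\<close> at \<open>z\<close>.\<close>
    define z where "z = (\<lambda>l. \<Sum>j<dA * dB. cnj (W j l) * v j)"
    have "(\<Sum>i<dA * dB. \<Sum>j<dA * dB. cnj (v i) * state $$ (i, j) * v j) =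
      (\<Sum>i<dA * dB. \<Sum>j<dA * dB. \<Sum>k<dA. \<Sum>l<dA. cnj (v i) * W i k * weight k l * (cnj (W j l) * v j))"
      by (intro sum.cong refl) (simp add: index_state sandwich_def sum_distrib_left sum_distrib_right mult_ac)
    also have "\<dots> = (\<Sum>k<dA. \<Sum>l<dA. \<Sum>i<dA * dB. \<Sum>j<dA * dB. cnj (v i) * W i k * weight k l * (cnj (W j l) * v j))"
      by (simp only: sum.swap[of _ "{..<dA}" "{..<dA * dB}"])
    also have "\<dots> = (\<Sum>k<dA. \<Sum>l<dA. cnj (z k) * weight k l * z l)"
      by (simp add: z_def sum_distrib_left sum_distrib_right cnj_sum mult_ac)
    finally show "0 \<le> Re (\<Sum>i<dA * dB. \<Sum>j<dA * dB. cnj (v i) * state $$ (i, j) * v j)"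
      using weight_nonneg by simp
  qed
  then show ?thesis
    unfolding choi_set_iff using weight_trace by (simp add: index_state index_less)
qed

lemma choi_component_eq_state:
  assumes A: "A \<in> choi_set dA dB" and B: "B \<in> choi_set dA dB" and t: "0 < t" "t < 1"
    and E: "state = complex_of_real t \<cdot>\<^sub>m A + complex_of_real (1 - t) \<cdot>\<^sub>m B"
  shows "A = state"
proof -
  txt \<open>Vectors annihilated by \<open>state\<close> are annihilated by \<open>A\<close>, so \<open>A = W Q W\<^sup>*\<close>
    for some \<open>Q\<close>, and the trace condition forces \<open>Q = weight\<close>.\<close>
  let ?N = "dA * dB"
  have cA: "A \<in> carrier_mat ?N ?N" and cB: "B \<in> carrier_mat ?N ?N"
    using A B by (auto simp: choi_set_iff)
  have "psd A" "psd B" using A B by (auto simp: choi_set_iff)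
  then have hA: "\<And>i j. i < ?N \<Longrightarrow> j < ?N \<Longrightarrow> A $$ (i, j) = cnj (A $$ (j, i))"
    and pA: "\<And>v. 0 \<le> Re (\<Sum>i<?N. \<Sum>j<?N. cnj (v i) * A $$ (i, j) * v j)"
    and pB: "\<And>v. 0 \<le> Re (\<Sum>i<?N. \<Sum>j<?N. cnj (v i) * B $$ (i, j) * v j)"
    unfolding psd_iff[OF cA] psd_iff[OF cB] by blast+
  have col: "A $$ (q, r) = (\<Sum>l<dA. A $$ (q, l * dB) * cnj (W r l))" if q: "q < ?N" and r: "r < ?N" for q r
  proof -
    \<comment> \<open>Unit vector \<open>r\<close> minus the combination of the unit vectors
      \<open>l * dB\<close> with coefficients \<open>cnj (W r l)\<close>. By
      \<open>sandwich_eq_top_sum\<close> it is annihilated by \<open>state\<close>; that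
      \<open>A\<close> annihilates it too is exactly the claimed relation.\<close>
    define v where "v = (\<lambda>s. (if s = r then 1 else 0) - (if s mod dB = 0 then cnj (W r (s div dB)) else 0))"
    have v: "(\<Sum>s<?N. f s * v s) = f r - (\<Sum>l<dA. f (l * dB) * cnj (W r l))" for f
    proof -
      have "(\<Sum>s<?N. f s * v s) = (\<Sum>s<?N. (if s = r then f s else 0) -
          (if s mod dB = 0 then f s * cnj (W r (s div dB)) else 0))"
        by (intro sum.cong refl) (simp add: v_def algebra_simps)
      also have "\<dots> = f r - (\<Sum>l<dA. f (l * dB) * cnj (W r l))"
        using r dB by (simp add: sum_subtractf sum_multiples)
      finally show ?thesis .
    qed
    have "(\<Sum>j<?N. state $$ (i, j) * v j) = 0" if i: "i < ?N" for i
      using i r dB by (simp add: v index_state sandwich_eq_top_sum[of weight i r] cong: sum.cong_simp)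
    then have "(\<Sum>i<?N. cnj (v i) * (\<Sum>j<?N. state $$ (i, j) * v j)) = 0" by simp
    then have "(\<Sum>i<?N. \<Sum>j<?N. cnj (v i) * state $$ (i, j) * v j) = 0"
      by (simp only: sum_distrib_left mult.assoc)
    moreover have "(\<Sum>i<?N. \<Sum>j<?N. cnj (v i) * state $$ (i, j) * v j) =
      of_real t * (\<Sum>i<?N. \<Sum>j<?N. cnj (v i) * A $$ (i, j) * v j) +
      of_real (1 - t) * (\<Sum>i<?N. \<Sum>j<?N. cnj (v i) * B $$ (i, j) * v j)"
      unfolding E sum_distrib_left sum.distrib[symmetric] using cA cB
      by (intro sum.cong refl) (simp add: algebra_simps)
    ultimately have "of_real t * (\<Sum>i<?N. \<Sum>j<?N. cnj (v i) * A $$ (i, j) * v j) +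
      of_real (1 - t) * (\<Sum>i<?N. \<Sum>j<?N. cnj (v i) * B $$ (i, j) * v j) = 0" by (simp only:)
    from arg_cong[where f = Re, OF this]
    have "t * Re (\<Sum>i<?N. \<Sum>j<?N. cnj (v i) * A $$ (i, j) * v j) +
      (1 - t) * Re (\<Sum>i<?N. \<Sum>j<?N. cnj (v i) * B $$ (i, j) * v j) = 0"
      by (simp only: plus_complex.sel times_complex.sel Re_complex_of_real Im_complex_of_real
        zero_complex.sel mult_zero_left diff_zero)
    \<comment> \<open>Two nonnegative terms with sum 0: the form of \<open>A\<close> vanishes at
      \<open>v\<close>, and \<open>psd_null_vector\<close> applies.\<close>
    moreover have "0 \<le> (1 - t) * Re (\<Sum>i<?N. \<Sum>j<?N. cnj (v i) * B $$ (i, j) * v j)"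
      using pB[of v] t by (intro mult_nonneg_nonneg) auto
    ultimately have "t * Re (\<Sum>i<?N. \<Sum>j<?N. cnj (v i) * A $$ (i, j) * v j) \<le> 0" by linarith
    then have "Re (\<Sum>i<?N. \<Sum>j<?N. cnj (v i) * A $$ (i, j) * v j) = 0"
      using t pA[of v] by (simp add: mult_le_0_iff)
    then have "(\<Sum>j<?N. A $$ (q, j) * v j) = 0"
      using psd_null_vector[of ?N "\<lambda>i j. A $$ (i, j)" v q] hA pA q by blast
    then show ?thesis by (simp add: v)
  qed
  \<comment> \<open>The identity block leaves no other choice: by \<open>sandwich_top\<close> the
    middle factor is the submatrix with \<open>b = b' = 0\<close>.\<close>
  define Q where "Q = (\<lambda>k l. A $$ (k * dB, l * dB))"
  have top: "k * dB < ?N" if "k < dA" for k using that dB by simp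
  have AQ: "A $$ (q, r) = sandwich dA W Q q r" if q: "q < ?N" and r: "r < ?N" for q r
  proof -
    \<comment> \<open>The relation \<open>col\<close> for rows instead of columns, by Hermitian
      symmetry.\<close>
    have "A $$ (q, l * dB) = (\<Sum>k<dA. W q k * Q k l)" if l: "l < dA" for l
    proof -
      have "A $$ (q, l * dB) = cnj (A $$ (l * dB, q))" using hA[OF q top[OF l]] .
      also have "\<dots> = (\<Sum>k<dA. cnj (A $$ (l * dB, k * dB)) * W q k)"
        by (subst col[OF top[OF l] q]) (simp add: cnj_sum)
      also have "\<dots> = (\<Sum>k<dA. W q k * Q k l)"
      proof (intro sum.cong refl)
        fix k assume "k \<in> {..<dA}"
        then have "A $$ (k * dB, l * dB) = cnj (A $$ (l * dB, k * dB))" using hA top l by blast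
        then show "cnj (A $$ (l * dB, k * dB)) * W q k = W q k * Q k l" by (simp add: Q_def)
      qed
      finally show ?thesis .
    qed
    then show ?thesis
      unfolding col[OF q r] sandwich_eq_top_sum[of Q q r] by (intro sum.cong refl) (simp add: sandwich_top_right)
  qed
  have "Q a a' = weight a a'" if "a < dA" "a' < dA" for a a'
  proof (rule partial_trace_inj[OF _ that])
    fix a a' assume a: "a < dA" "a' < dA"
    have "(\<Sum>b<dB. sandwich dA W Q (a * dB + b) (a' * dB + b)) = (\<Sum>b<dB. A $$ (a * dB + b, a' * dB + b))"
      using a by (intro sum.cong refl) (simp add: AQ index_less)
    then show "(\<Sum>b<dB. sandwich dA W Q (a * dB + b) (a' * dB + b)) =
        (\<Sum>b<dB. sandwich dA W weight (a * dB + b) (a' * dB + b))"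
      using A a weight_trace[OF a] by (simp add: choi_set_iff)
  qed
  then have "A $$ (q, r) = state $$ (q, r)" if "q < ?N" "r < ?N" for q r
    using that by (simp add: AQ index_state) (rule sandwich_cong, blast)
  then show ?thesis using cA by (intro eq_matI) (auto simp: state_def)
qed

lemma state_extreme: "extreme_mat (choi_set dA dB) state"
  unfolding extreme_mat_def
proof (intro conjI ballI allI impI)
  fix A B and t :: real assume AB: "A \<in> choi_set dA dB" "B \<in> choi_set dA dB"
    and "0 < t \<and> t < 1 \<and> state = complex_of_real t \<cdot>\<^sub>m A + complex_of_real (1 - t) \<cdot>\<^sub>m B"
  then have t: "0 < t" "t < 1" and E: "state = complex_of_real t \<cdot>\<^sub>m A + complex_of_real (1 - t) \<cdot>\<^sub>m B"
    by auto
  show "A = state" using choi_component_eq_state[OF AB t E] .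
  have "state = complex_of_real (1 - t) \<cdot>\<^sub>m B + complex_of_real (1 - (1 - t)) \<cdot>\<^sub>m A"
    unfolding E using AB by (simp, intro comm_add_mat) (auto simp: choi_set_iff)
  then show "B = state" using choi_component_eq_state[OF AB(2,1), of "1 - t"] t by simp
qed (rule state_in_choi_set)

text \<open>The columns with \<open>b = 0\<close> form \<open>W P\<close>, and multiplying by
  \<open>W^*\<close> gives \<open>state\<close>. Restricting \<open>W P v\<close> to the rows with
  \<open>b = 0\<close> leaves \<open>P v\<close>, so \<open>W P\<close> is injective.\<close>

lemma state_rank: "vec_space.rank (dA * dB) state = dA"
proof (rule vec_space.rank_eq_if_generated)
  let ?N = "dA * dB"
  define B where "B = mat ?N dA (\<lambda>(r, k). state $$ (r, k * dB))"
  define D where "D = mat dA ?N (\<lambda>(l, s). cnj (W s l))"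
  have top: "k * dB < ?N" if "k < dA" for k using that dB by simp
  show "state \<in> carrier_mat ?N ?N" by simp
  show cB: "B \<in> carrier_mat ?N dA" and "D \<in> carrier_mat dA ?N" by (simp_all add: B_def D_def)
  show "set (cols B) \<subseteq> set (cols state)"
  proof
    fix x assume "x \<in> set (cols B)"
    then obtain k where k: "k < dA" "x = col B k"
      using cB by (metis carrier_matD(2) cols_length cols_nth in_set_conv_nth)
    then have "x = col state (k * dB)"
      using top by (intro eq_vecI) (auto simp: B_def state_def)
    moreover have "col state (k * dB) \<in> set (cols state)"
      using top[OF k(1)] by (simp add: cols_def state_def)
    ultimately show "x \<in> set (cols state)" by simp
  qed
  show "state = B * D"
  proof (rule eq_matI)
    fix i j assume "i < dim_row (B * D)" "j < dim_col (B * D)"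
    then have ij: "i < ?N" "j < ?N" by (simp_all add: B_def D_def)
    have "(B * D) $$ (i, j) = (\<Sum>l<dA. state $$ (i, l * dB) * cnj (W j l))"
      using ij by (simp add: B_def D_def scalar_prod_def lessThan_atLeast0)
    also have "\<dots> = sandwich dA W weight i j"
      unfolding sandwich_eq_top_sum[of weight i j] using ij top by (intro sum.cong refl) (simp add: index_state)
    finally show "state $$ (i, j) = (B * D) $$ (i, j)" using ij by (simp add: index_state)
  qed (simp_all add: B_def D_def state_def)
  fix v :: "complex vec" assume v: "v \<in> carrier_vec dA" and Bv: "B *\<^sub>v v = 0\<^sub>v ?N"
  have "cmod (cnj (vec_index v k)) \<le> 2 * (real dA * 0)" if k: "k < dA" for k
  proof (rule weight_inverse_bound[OF _ k])
    fix l assume l: "l < dA"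
    have "0 = vec_index (B *\<^sub>v v) (l * dB)" using Bv top[OF l] by simp
    also have "\<dots> = (\<Sum>k<dA. weight l k * vec_index v k)"
      using top l v by (simp add: B_def scalar_prod_def lessThan_atLeast0 index_state sandwich_top)
    finally have "0 = cnj (\<Sum>k<dA. weight l k * vec_index v k)" by simp
    also have "\<dots> = (\<Sum>k<dA. cnj (vec_index v k) * weight k l)"
      unfolding cnj_sum
    proof (intro sum.cong refl)
      fix k assume "k \<in> {..<dA}"
      then have "weight k l = cnj (weight l k)" using weight_hermitian l by blast
      then show "cnj (weight l k * vec_index v k) = cnj (vec_index v k) * weight k l" by simp
    qed
    finally show "cmod (\<Sum>k<dA. cnj (vec_index v k) * weight k l) \<le> 0" by simp
  qed
  then show "v = 0\<^sub>v dA" using v by (intro eq_vecI) auto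
qed

lemma state_in_choi_extreme_rank: "state \<in> choi_extreme_rank dA dB dA"
  using state_extreme state_rank by (simp add: choi_extreme_rank_def state_def)

end

section \<open>Lipschitz recovery of the frame from its state\<close>

text \<open>Uses \<open>(W - W') P = (W P - W' P') + W' (P' - P)\<close>. The entries of
  \<open>W P - W' P'\<close> and of \<open>P' - P\<close> are differences of state entries, and
  those of \<open>W'\<close> are at most 1 in modulus, which gives
  \<open>(1 + dA) * \<beta>\<close>; inverting \<open>P\<close> costs the factor
  \<open>2 * dA\<close>.\<close>

lemma frame_diff_bound:
  assumes "frame dA dB W" "frame dA dB W'"
    and close: "\<And>r s. r < dA * dB \<Longrightarrow> s < dA * dB \<Longrightarrow>
      cmod (frame.state dA dB W $$ (r, s) - frame.state dA dB W' $$ (r, s)) \<le> \<beta>"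
    and r: "r < dA * dB" and k: "k < dA"
  shows "cmod (W r k - W' r k) \<le> 2 * (real dA * ((1 + real dA) * \<beta>))"
proof -
  interpret F: frame dA dB W by fact
  interpret F': frame dA dB W' by fact
  have top: "k * dB < dA * dB" if "k < dA" for k using that F.dB by simp
  show ?thesis
  proof (rule F.weight_inverse_bound[OF _ k])
    fix l assume l: "l < dA"
    have "(\<Sum>k<dA. (W r k - W' r k) * F.weight k l) =
      (\<Sum>k<dA. W r k * F.weight k l) - (\<Sum>k<dA. W' r k * F'.weight k l)
       + (\<Sum>k<dA. W' r k * (F'.weight k l - F.weight k l))"
      by (simp add: algebra_simps sum.distrib sum_subtractf)
    also have "(\<Sum>k<dA. W r k * F.weight k l) - (\<Sum>k<dA. W' r k * F'.weight k l) =
      F.state $$ (r, l * dB) - F'.state $$ (r, l * dB)"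
      using r l top by (simp add: F.index_state F'.index_state F.sandwich_top_right F'.sandwich_top_right)
    finally have "cmod (\<Sum>k<dA. (W r k - W' r k) * F.weight k l) \<le>
      cmod (F.state $$ (r, l * dB) - F'.state $$ (r, l * dB)) + cmod (\<Sum>k<dA. W' r k * (F'.weight k l - F.weight k l))"
      by (simp add: norm_triangle_ineq)
    also have "\<dots> \<le> \<beta> + (\<Sum>k<dA. 1 * \<beta>)"
    proof (intro add_mono sum_norm_le)
      show "cmod (F.state $$ (r, l * dB) - F'.state $$ (r, l * dB)) \<le> \<beta>" using close r top l by blast
      fix k assume k: "k \<in> {..<dA}"
      then have "cmod (F.weight k l - F'.weight k l) \<le> \<beta>"
        using close[of "k * dB" "l * dB"] top l
        by (simp add: F.index_state F'.index_state F.sandwich_top F'.sandwich_top)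
      then show "cmod (W' r k * (F'.weight k l - F.weight k l)) \<le> 1 * \<beta>"
        unfolding norm_mult using F'.W_le_1[OF r, of k] k by (intro mult_mono) (auto simp: norm_minus_commute)
    qed
    finally show "cmod (\<Sum>k<dA. (W r k - W' r k) * F.weight k l) \<le> (1 + real dA) * \<beta>"
      by (simp add: algebra_simps)
  qed
qed

section \<open>Choi states of circuits\<close>

lemma mult_ketbra_adjoint_index:
  assumes V: "V \<in> carrier_mat m n" and ij: "i < n" "j < n" and xy: "x < m" "y < m"
  shows "(V * ketbra n i j * mat_adjoint V) $$ (x, y) = V $$ (x, i) * cnj (V $$ (y, j))"
proof -
  have K: "(V * ketbra n i j) $$ (x, l) = (if l = j then V $$ (x, i) else 0)" if "l < n" for l
  proof -
    have "(V * ketbra n i j) $$ (x, l) = (\<Sum>k<n. V $$ (x, k) * (if k = i \<and> l = j then 1 else 0))"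
      using V that xy by (simp add: ketbra_def scalar_prod_def lessThan_atLeast0)
    also have "\<dots> = (\<Sum>k<n. if k = i then (if l = j then V $$ (x, i) else 0) else 0)"
      by (intro sum.cong) auto
    finally show ?thesis using ij by simp
  qed
  have "(V * ketbra n i j * mat_adjoint V) $$ (x, y) = (\<Sum>l<n. (V * ketbra n i j) $$ (x, l) * cnj (V $$ (y, l)))"
    using V xy by (simp add: ketbra_def scalar_prod_def lessThan_atLeast0)
  also have "\<dots> = (\<Sum>l<n. if l = j then V $$ (x, i) * cnj (V $$ (y, j)) else 0)"
    by (intro sum.cong) (auto simp: K)
  finally show ?thesis using ij by simp
qed

lemma choi_carrier [simp]: "choi dA dB dC V \<in> carrier_mat (dA * dB) (dA * dB)"
  by (simp add: choi_def)

text \<open>Each \<open>c\<close> stands for one Kraus operator, so the Choi state is a sum of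
  \<open>dC\<close> terms of rank at most one, with entries polynomial in those of \<open>V\<close>
  and their conjugates.\<close>

lemma choi_index:
  assumes V: "V \<in> carrier_mat (dB * dC) dA" and rs: "r < dA * dB" "s < dA * dB"
  shows "choi dA dB dC V $$ (r, s) = 1 / of_nat dA *
    (\<Sum>c<dC. V $$ (c * dB + r mod dB, r div dB) * cnj (V $$ (c * dB + s mod dB, s div dB)))"
proof -
  have dB: "0 < dB" using rs by (cases dB) auto
  have div: "r div dB < dA" "s div dB < dA" using rs by (auto simp: less_mult_imp_div_less)
  have lt: "c * dB + b < dB * dC" if "c < dC" "b < dB" for c b
    using index_less[OF that] by (simp add: mult.commute)
  show ?thesis
    using dB rs div
    by (simp add: choi_def channel_def ptrace_C_def mult_ketbra_adjoint_index[OF V] lt)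
qed

text \<open>Padding with zero rows gives a singular square system: its row \<open>m\<close> is zero,
  so the transpose annihilates unit vector \<open>m\<close>.\<close>

lemma underdetermined_nonzero_solution:
  fixes M :: "complex mat"
  assumes "m < n"
  shows "\<exists>x. (\<exists>k<n. x k \<noteq> 0) \<and> (\<forall>c<m. (\<Sum>a<n. M $$ (c, a) * x a) = 0)"
proof -
  define S where "S = mat n n (\<lambda>(c, a). if c < m then M $$ (c, a) else 0)"
  have S: "S \<in> carrier_mat n n" by (simp add: S_def)
  have "S\<^sup>T *\<^sub>v unit_vec n m = 0\<^sub>v n"
    using assms by (intro eq_vecI) (auto simp: S_def)
  then have "Determinant.det S\<^sup>T = 0"
    using assms S by (subst det_0_iff_vec_prod_zero_field[of _ n]) (auto intro!: exI[of _ "unit_vec n m"])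
  then have "Determinant.det S = 0" using det_transpose[OF S] by simp
  then obtain v where v: "v \<in> carrier_vec n" "v \<noteq> 0\<^sub>v n" "S *\<^sub>v v = 0\<^sub>v n"
    using det_0_iff_vec_prod_zero_field[OF S] by blast
  have "\<exists>k<n. vec_index v k \<noteq> 0"
    using v(1,2) by (auto simp: vec_eq_iff)
  moreover have "(\<Sum>a<n. M $$ (c, a) * vec_index v a) = 0" if c: "c < m" for c
  proof -
    have "0 = vec_index (S *\<^sub>v v) c" using v c assms by simp
    also have "\<dots> = (\<Sum>a<n. M $$ (c, a) * vec_index v a)"
      using v(1) c assms by (simp add: S_def scalar_prod_def lessThan_atLeast0)
    finally show ?thesis by simp
  qed
  ultimately show ?thesis by blast
qed

text \<open>The submatrix with \<open>b = b' = 0\<close> of the circuit's state has rank at most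
  \<open>dC\<close>, whereas in \<open>state\<close> it is the invertible
  \<open>weight\<close>.\<close>

lemma (in frame) choi_few_kraus_neq_state:
  assumes V: "V \<in> carrier_mat (dB * dC) dA" and less: "dC < dA"
  shows "choi dA dB dC V \<noteq> state"
proof
  assume eq: "choi dA dB dC V = state"
  obtain x k where k: "k < dA" "x k \<noteq> 0"
    and x: "\<And>c. c < dC \<Longrightarrow> (\<Sum>a<dA. mat dC dA (\<lambda>(c, a). V $$ (c * dB, a)) $$ (c, a) * x a) = 0"
    using underdetermined_nonzero_solution[OF less] by blast
  have top: "a * dB < dA * dB" if "a < dA" for a using that dB by simp
  have "cmod (x k) \<le> 2 * (real dA * 0)"
  proof (rule weight_inverse_bound[OF _ k(1)])
    fix l assume l: "l < dA"
    have "(\<Sum>a<dA. x a * weight a l) = (\<Sum>a<dA. x a * state $$ (a * dB, l * dB))"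
      using top l by (simp add: index_state sandwich_top)
    also have "\<dots> = (\<Sum>a<dA. \<Sum>c<dC. 1 / of_nat dA * cnj (V $$ (c * dB, l)) * (V $$ (c * dB, a) * x a))"
      unfolding eq[symmetric] using top l dB
      by (intro sum.cong refl) (simp add: choi_index[OF V] sum_distrib_left mult_ac)
    also have "\<dots> = (\<Sum>c<dC. 1 / of_nat dA * cnj (V $$ (c * dB, l)) * (\<Sum>a<dA. V $$ (c * dB, a) * x a))"
      unfolding sum_distrib_left by (rule sum.swap)
    also have "\<dots> = 0" using x by (intro sum.neutral) simp
    finally show "cmod (\<Sum>a<dA. x a * weight a l) \<le> 0" by simp
  qed
  then show False using k by simp
qed

section \<open>Real parameters of a frame\<close>

text \<open>The flag selects real or imaginary part. A complex number with both parts in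
  \<open>{0..1}\<close> has modulus at most 2, so the factor is half the bound allowed in
  \<open>frame\<close>.\<close>

definition frame_of :: "nat \<Rightarrow> nat \<Rightarrow> (nat \<times> nat \<times> bool \<Rightarrow> real) \<Rightarrow> nat \<Rightarrow> nat \<Rightarrow> complex" where
  "frame_of dA dB y r k = (if r mod dB = 0 then (if r div dB = k then 1 else 0)
     else of_real (1 / (4 * real dA ^ 2 * real dB)) * Complex (y (r, k, True)) (y (r, k, False)))"

definition frame_params :: "nat \<Rightarrow> nat \<Rightarrow> (nat \<times> nat \<times> bool) set" where
  "frame_params dA dB = {r \<in> {..<dA * dB}. r mod dB \<noteq> 0} \<times> {..<dA} \<times> UNIV"

lemma finite_frame_params [simp]: "finite (frame_params dA dB)"
  by (simp add: frame_params_def)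

text \<open>The threshold of the theorem: \<open>dA * (dB - 1)\<close> rows with nonzero
  \<open>b\<close>, \<open>dA\<close> columns and two real parts.\<close>

lemma card_frame_params:
  assumes "0 < dB"
  shows "card (frame_params dA dB) = 2 * dA\<^sup>2 * (dB - 1)"
proof -
  have "(\<Sum>s<dA * dB. if s mod dB = 0 then 1 else 0) = (\<Sum>k<dA. 1::nat)"
    by (rule sum_multiples[OF assms])
  then have "card {s \<in> {..<dA * dB}. s mod dB = 0} = dA"
    by (simp add: sum.If_cases Int_def)
  moreover have "{r \<in> {..<dA * dB}. r mod dB \<noteq> 0} = {..<dA * dB} - {s \<in> {..<dA * dB}. s mod dB = 0}"
    by auto
  moreover have "card ({..<dA * dB} - {s \<in> {..<dA * dB}. s mod dB = 0}) =
      dA * dB - card {s \<in> {..<dA * dB}. s mod dB = 0}"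
    by (subst card_Diff_subset) auto
  ultimately have "card {r \<in> {..<dA * dB}. r mod dB \<noteq> 0} = dA * dB - dA" by (simp only:)
  then show ?thesis
    by (simp add: frame_params_def card_cartesian_product power2_eq_square right_diff_distrib' mult_ac)
qed

lemma frame_frame_of:
  assumes dA: "0 < dA" and dB: "0 < dB" and y: "y \<in> frame_params dA dB \<rightarrow> {0..1}"
  shows "frame dA dB (frame_of dA dB y)"
proof
  fix r k assume r: "r < dA * dB" "r mod dB \<noteq> 0" and k: "k < dA"
  have "y (r, k, b) \<in> {0..1}" for b
    using y r k by (auto simp: frame_params_def Pi_iff)
  from this[of True] this[of False] have "cmod (Complex (y (r, k, True)) (y (r, k, False))) \<le> 2"
    using cmod_le[of "Complex (y (r, k, True)) (y (r, k, False))"] by simp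
  then have "cmod (frame_of dA dB y r k) \<le> 1 / (4 * real dA ^ 2 * real dB) * 2"
    using r unfolding frame_of_def by (simp only: if_False norm_mult norm_of_real) (intro mult_mono, auto)
  then show "cmod (frame_of dA dB y r k) \<le> 1 / (2 * real dA ^ 2 * real dB)" by (simp add: mult_ac)
qed (use assms in \<open>auto simp: frame_of_def\<close>)

section \<open>Regularity of the states generated by a circuit\<close>

text \<open>By \<open>choi_index\<close> the entries are polynomials in Lipschitz functions and
  their conjugates, and on the cube such functions are bounded and closed under products.\<close>

lemma choi_cube_lipschitz:
  assumes Z: "circuit_topology dA dB dC p h"
  shows "\<exists>L\<ge>0. \<forall>x\<in>cube p. \<forall>x'\<in>cube p. \<forall>\<delta>\<ge>0. (\<forall>k<p. \<bar>x k - x' k\<bar> \<le> \<delta>) \<longrightarrow>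
    (\<forall>r<dA * dB. \<forall>s<dA * dB. cmod (choi dA dB dC (h x) $$ (r, s) - choi dA dB dC (h x') $$ (r, s)) \<le> L * \<delta>)"
proof -
  have V: "h x \<in> carrier_mat (dB * dC) dA" if "x \<in> cube p" for x
    using Z that by (auto simp: circuit_topology_def isometries_def)
  have dB: "0 < dB" using Z by (simp add: circuit_topology_def)
  have "\<exists>L\<ge>0. \<forall>x\<in>cube p. \<forall>x'\<in>cube p. \<forall>\<delta>\<ge>0. (\<forall>k<p. \<bar>x k - x' k\<bar> \<le> \<delta>) \<longrightarrow>
    cmod (choi dA dB dC (h x) $$ (r, s) - choi dA dB dC (h x') $$ (r, s)) \<le> L * \<delta>"
    if r: "r < dA * dB" and s: "s < dA * dB" for r s
  proof -
    have lip: "cube_lipschitz p (\<lambda>x. h x $$ (a, b))" if "a < dB * dC" "b < dA" for a b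
      using Z that unfolding circuit_topology_def by (intro smooth_cube_imp_lipschitz) auto
    have "c * dB + t mod dB < dB * dC" if "c < dC" for c t
      using index_less[OF that, of "t mod dB" dB] dB by (simp add: mult.commute)
    then have "cube_lipschitz p (\<lambda>x. 1 / of_nat dA *
      (\<Sum>c<dC. h x $$ (c * dB + r mod dB, r div dB) * cnj (h x $$ (c * dB + s mod dB, s div dB))))"
      using r s
      by (intro cube_lipschitz_mult cube_lipschitz_const cube_lipschitz_sum cube_lipschitz_cnj lip)
        (auto simp: less_mult_imp_div_less)
    then obtain L where L: "L \<ge> 0" "\<forall>x\<in>cube p. \<forall>x'\<in>cube p. \<forall>\<delta>\<ge>0. (\<forall>k<p. \<bar>x k - x' k\<bar> \<le> \<delta>) \<longrightarrow>
      cmod (1 / of_nat dA * (\<Sum>c<dC. h x $$ (c * dB + r mod dB, r div dB) * cnj (h x $$ (c * dB + s mod dB, s div dB))) -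
        1 / of_nat dA * (\<Sum>c<dC. h x' $$ (c * dB + r mod dB, r div dB) * cnj (h x' $$ (c * dB + s mod dB, s div dB)))) \<le> L * \<delta>"
      unfolding cube_lipschitz_def by blast
    show ?thesis
    proof (intro exI[of _ L] conjI ballI allI impI)
      fix x x' \<delta> assume x: "x \<in> cube p" "x' \<in> cube p" and "0 \<le> \<delta>" "\<forall>k<p. \<bar>x k - x' k\<bar> \<le> \<delta>"
      then show "cmod (choi dA dB dC (h x) $$ (r, s) - choi dA dB dC (h x') $$ (r, s)) \<le> L * \<delta>"
        unfolding choi_index[OF V[OF x(1)] r s] choi_index[OF V[OF x(2)] r s] using L(2) by blast
    qed (rule L(1))
  qed
  then obtain L where L0: "\<And>r s. r < dA * dB \<Longrightarrow> s < dA * dB \<Longrightarrow> 0 \<le> L r s"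
    and L: "\<And>r s x x' \<delta>. r < dA * dB \<Longrightarrow> s < dA * dB \<Longrightarrow> x \<in> cube p \<Longrightarrow> x' \<in> cube p \<Longrightarrow> 0 \<le> \<delta> \<Longrightarrow>
      (\<forall>k<p. \<bar>x k - x' k\<bar> \<le> \<delta>) \<Longrightarrow>
      cmod (choi dA dB dC (h x) $$ (r, s) - choi dA dB dC (h x') $$ (r, s)) \<le> L r s * \<delta>"
    by metis
  \<comment> \<open>A single constant that dominates those of all entries.\<close>
  define M where "M = (\<Sum>r<dA * dB. \<Sum>s<dA * dB. L r s)"
  have LM: "L r s \<le> M" if "r < dA * dB" "s < dA * dB" for r s
  proof -
    have "L r s \<le> (\<Sum>s<dA * dB. L r s)" using that L0 by (intro member_le_sum) auto
    also have "\<dots> \<le> M" unfolding M_def using that L0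
      by (intro member_le_sum[where f = "\<lambda>r. \<Sum>s<dA * dB. L r s"]) (auto intro: sum_nonneg)
    finally show ?thesis .
  qed
  show ?thesis
  proof (intro exI[of _ M] conjI ballI allI impI)
    show "0 \<le> M" unfolding M_def using L0 by (intro sum_nonneg) auto
    fix x x' r s and \<delta> :: real
    assume h: "x \<in> cube p" "x' \<in> cube p" "0 \<le> \<delta>" "\<forall>k<p. \<bar>x k - x' k\<bar> \<le> \<delta>" and rs: "r < dA * dB" "s < dA * dB"
    show "cmod (choi dA dB dC (h x) $$ (r, s) - choi dA dB dC (h x') $$ (r, s)) \<le> M * \<delta>"
      using L[OF rs h] mult_right_mono[OF LM[OF rs] h(3)] by linarith
  qed
qed

lemma mat_dist_pos:
  assumes "X \<in> carrier_mat m n" "Y \<in> carrier_mat m n" "X \<noteq> Y"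
  shows "0 < mat_dist X Y"
proof -
  obtain i j where ij: "i < m" "j < n" "X $$ (i, j) \<noteq> Y $$ (i, j)"
    using assms by (auto simp: mat_eq_iff)
  have "0 < (cmod (X $$ (i, j) - Y $$ (i, j)))\<^sup>2" using ij by simp
  also have "\<dots> \<le> (\<Sum>j<n. (cmod (X $$ (i, j) - Y $$ (i, j)))\<^sup>2)"
    using ij by (intro member_le_sum) auto
  also have "\<dots> \<le> (\<Sum>i<m. \<Sum>j<n. (cmod (X $$ (i, j) - Y $$ (i, j)))\<^sup>2)"
    using ij by (intro member_le_sum[where f = "\<lambda>i. \<Sum>j<n. (cmod (X $$ (i, j) - Y $$ (i, j)))\<^sup>2"])
      (auto intro: sum_nonneg)
  finally show ?thesis using assms by (simp add: mat_dist_def)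
qed

text \<open>The distance to \<open>E0\<close> is continuous in the circuit parameters, so it attains
  its minimum on the compact cube, and the minimum is positive because \<open>E0\<close> is not
  hit.\<close>

lemma generated_set_positive_distance:
  assumes Z: "circuit_topology dA dB dC p h" and E: "E0 \<in> carrier_mat (dA * dB) (dA * dB)"
    and notin: "E0 \<notin> generated_set dA dB dC p h"
  shows "\<exists>\<epsilon>>0. \<forall>E \<in> generated_set dA dB dC p h. \<epsilon> \<le> mat_dist E E0"
proof -
  let ?N = "dA * dB"
  have V: "h x \<in> carrier_mat (dB * dC) dA" if "x \<in> cube p" for x
    using Z that by (auto simp: circuit_topology_def isometries_def)
  have dB: "0 < dB" using Z by (simp add: circuit_topology_def)
  have cont: "continuous_on (cube p) (\<lambda>x. h x $$ (a, b))" if "a < dB * dC" "b < dA" for a b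
    using Z that unfolding circuit_topology_def by (intro smooth_cube_imp_continuous) auto
  have lt: "c * dB + t mod dB < dB * dC" if "c < dC" for c t
    using index_less[OF that, of "t mod dB" dB] dB by (simp add: mult.commute)
  have entry: "continuous_on (cube p) (\<lambda>x. choi dA dB dC (h x) $$ (r, s))" if r: "r < ?N" and s: "s < ?N" for r s
  proof -
    have "continuous_on (cube p) (\<lambda>x. 1 / of_nat dA *
      (\<Sum>c<dC. h x $$ (c * dB + r mod dB, r div dB) * cnj (h x $$ (c * dB + s mod dB, s div dB))))"
      using r s lt by (intro continuous_intros cont) (auto simp: less_mult_imp_div_less)
    then show ?thesis
      by (rule continuous_on_eq) (simp add: choi_index[OF V r s])
  qed
  define d where "d = (\<lambda>x. mat_dist (choi dA dB dC (h x)) E0)"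
  have "d = (\<lambda>x. sqrt (\<Sum>i<?N. \<Sum>j<?N. (cmod (choi dA dB dC (h x) $$ (i, j) - E0 $$ (i, j)))\<^sup>2))"
    by (simp add: d_def mat_dist_def choi_def)
  then have "continuous_on (cube p) d"
    by (auto intro!: continuous_intros entry)
  then obtain x0 where x0: "x0 \<in> cube p" "\<forall>x\<in>cube p. d x0 \<le> d x"
    using continuous_attains_inf[OF compact_cube] zero_in_cube by blast
  have "choi dA dB dC (h x0) \<noteq> E0" using notin x0(1) by (auto simp: generated_set_def)
  then have "0 < d x0" unfolding d_def by (rule mat_dist_pos[OF choi_carrier E])
  then show ?thesis using x0(2) by (auto simp: generated_set_def d_def)
qed

theorem theorem6:
  fixes dA dB q :: nat
    and dC p :: "nat \<Rightarrow> nat"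
    and h :: "nat \<Rightarrow> (nat \<Rightarrow> real) \<Rightarrow> complex mat"
  assumes "0 < dA" and "0 < dB" and "0 < q"
    and topo: "\<forall>i\<in>{1..q}. circuit_topology dA dB (dC i) (p i) (h i)"
    and small: "\<forall>i\<in>{1..q}. p i < 2 * dA\<^sup>2 * (dB - 1) \<or> dC i < dA"
  shows "\<exists>E0 \<in> choi_extreme_rank dA dB dA. \<exists>\<epsilon>>0.
           \<forall>E \<in> choi_set dA dB. mat_dist E E0 < \<epsilon> \<longrightarrow>
              E \<notin> (\<Union>i\<in>{1..q}. generated_set dA dB (dC i) (p i) (h i))"
proof -
  let ?J = "frame_params dA dB"
  define C where "C = (\<lambda>y. frame.state dA dB (frame_of dA dB y))"
  define \<eta> where "\<eta> = 1 / (4 * real dA ^ 2 * real dB)"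
  have \<eta>: "0 < \<eta>" using assms(1,2) by (simp add: \<eta>_def)
  have fr: "frame dA dB (frame_of dA dB y)" if "y \<in> ?J \<rightarrow> {0..1}" for y
    using frame_frame_of[OF assms(1,2) that] .
  \<comment> \<open>Only these topologies are handled by counting. The others have
    \<open>dC i < dA\<close> and miss the state of every frame, whichever \<open>y\<close> is
    chosen.\<close>
  define G where "G = {i \<in> {1..q}. p i < card ?J}"
  have "\<exists>y \<in> ?J \<rightarrow> {0..1}. \<forall>i\<in>G. C y \<notin> (\<lambda>x. choi dA dB (dC i) (h i x)) ` cube (p i)"
  proof (rule exists_parameter_avoiding_images)
    fix i assume i: "i \<in> G"
    then have "circuit_topology dA dB (dC i) (p i) (h i)" using topo by (simp add: G_def)
    from choi_cube_lipschitz[OF this] obtain L where L0: "0 \<le> L"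
      and L: "\<And>x x' \<delta> r s. x \<in> cube (p i) \<Longrightarrow> x' \<in> cube (p i) \<Longrightarrow> 0 \<le> \<delta> \<Longrightarrow> (\<forall>k<p i. \<bar>x k - x' k\<bar> \<le> \<delta>) \<Longrightarrow>
        r < dA * dB \<Longrightarrow> s < dA * dB \<Longrightarrow>
        cmod (choi dA dB (dC i) (h i x) $$ (r, s) - choi dA dB (dC i) (h i x') $$ (r, s)) \<le> L * \<delta>"
      by blast
    \<comment> \<open>The factor of \<open>frame_diff_bound\<close> times the Lipschitz constant of
      the circuit, divided by the scale \<open>\<eta>\<close> of \<open>frame_of\<close>.\<close>
    define M where "M = 2 * (real dA * ((1 + real dA) * L)) / \<eta>"
    show "\<exists>L\<ge>0. \<forall>x\<in>cube (p i). \<forall>x'\<in>cube (p i). \<forall>y \<in> ?J \<rightarrow> {0..1}. \<forall>y' \<in> ?J \<rightarrow> {0..1}. \<forall>\<delta>\<ge>0.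
       C y = choi dA dB (dC i) (h i x) \<longrightarrow> C y' = choi dA dB (dC i) (h i x') \<longrightarrow>
       (\<forall>k<p i. \<bar>x k - x' k\<bar> \<le> \<delta>) \<longrightarrow> (\<forall>j\<in>?J. \<bar>y j - y' j\<bar> \<le> L * \<delta>)"
    proof (intro exI[of _ M] conjI ballI allI impI)
      show "0 \<le> M" using L0 \<eta> by (simp add: M_def)
      fix x x' y y' j and \<delta> :: real
      assume x: "x \<in> cube (p i)" "x' \<in> cube (p i)" "0 \<le> \<delta>" "\<forall>k<p i. \<bar>x k - x' k\<bar> \<le> \<delta>"
        and y: "y \<in> ?J \<rightarrow> {0..1}" "y' \<in> ?J \<rightarrow> {0..1}"
        and eq: "C y = choi dA dB (dC i) (h i x)" "C y' = choi dA dB (dC i) (h i x')"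
        and j: "j \<in> ?J"
      obtain r k b where j': "j = (r, k, b)" by (cases j) auto
      then have rk: "r < dA * dB" "r mod dB \<noteq> 0" "k < dA" using j by (auto simp: frame_params_def)
      \<comment> \<open>The unscaled difference of the two frame entries; \<open>y j - y' j\<close>
        is its real or its imaginary part, according to \<open>b\<close>.\<close>
      define W where "W = Complex (y (r, k, True) - y' (r, k, True)) (y (r, k, False) - y' (r, k, False))"
      have "cmod (frame_of dA dB y r k - frame_of dA dB y' r k) \<le> 2 * (real dA * ((1 + real dA) * (L * \<delta>)))"
        using L[OF x] eq unfolding C_def
        by (intro frame_diff_bound[OF fr[OF y(1)] fr[OF y(2)] _ rk(1,3)]) auto
      moreover have "frame_of dA dB y r k - frame_of dA dB y' r k = of_real \<eta> * W"
        using rk(2) by (simp add: frame_of_def \<eta>_def W_def complex_eq_iff diff_divide_distrib)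
      ultimately have "\<eta> * cmod W \<le> 2 * (real dA * ((1 + real dA) * (L * \<delta>)))"
        using \<eta> by (simp add: norm_mult)
      then have "cmod W \<le> M * \<delta>" using \<eta> by (simp add: M_def le_divide_eq mult_ac)
      moreover have "\<bar>y j - y' j\<bar> \<le> cmod W"
        using abs_Re_le_cmod[of W] abs_Im_le_cmod[of W] unfolding j' W_def by (cases b) auto
      ultimately show "\<bar>y j - y' j\<bar> \<le> M * \<delta>" by linarith
    qed
  qed (auto simp: G_def)
  then obtain y where y: "y \<in> ?J \<rightarrow> {0..1}"
    and avoid: "\<And>i. i \<in> G \<Longrightarrow> C y \<notin> (\<lambda>x. choi dA dB (dC i) (h i x)) ` cube (p i)" by blast
  interpret F: frame dA dB "frame_of dA dB y" using fr[OF y] .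
  have notin: "C y \<notin> generated_set dA dB (dC i) (p i) (h i)" if i: "i \<in> {1..q}" for i
  proof (cases "dC i < dA")
    case True
    have "h i x \<in> carrier_mat (dB * dC i) dA" if "x \<in> cube (p i)" for x
      using topo i that by (auto simp: circuit_topology_def isometries_def)
    then show ?thesis
      using F.choi_few_kraus_neq_state[OF _ True] by (force simp: generated_set_def C_def)
  next
    case False
    then have "i \<in> G" using small i by (auto simp: G_def card_frame_params[OF assms(2)])
    then show ?thesis using avoid by (simp add: generated_set_def image_image)
  qed
  have "\<exists>\<epsilon>>0. \<forall>E \<in> generated_set dA dB (dC i) (p i) (h i). \<epsilon> \<le> mat_dist E (C y)" if "i \<in> {1..q}" for i
    using topo that notin by (intro generated_set_positive_distance) (auto simp: C_def)
  then obtain e where e: "\<And>i. i \<in> {1..q} \<Longrightarrow> 0 < e i"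
    "\<And>i E. i \<in> {1..q} \<Longrightarrow> E \<in> generated_set dA dB (dC i) (p i) (h i) \<Longrightarrow> e i \<le> mat_dist E (C y)"
    by metis
  \<comment> \<open>Positive as a minimum over a finite set that \<open>0 < q\<close> makes
    nonempty.\<close>
  define \<epsilon> where "\<epsilon> = Min (e ` {1..q})"
  have "0 < \<epsilon>" unfolding \<epsilon>_def using e(1) \<open>0 < q\<close> by (subst Min_gr_iff) auto
  moreover have "\<epsilon> \<le> e i" if "i \<in> {1..q}" for i unfolding \<epsilon>_def using that by (intro Min_le) auto
  then have "E \<notin> (\<Union>i\<in>{1..q}. generated_set dA dB (dC i) (p i) (h i))" if "mat_dist E (C y) < \<epsilon>" for E
    using e(2) that by fastforce
  moreover have "C y \<in> choi_extreme_rank dA dB dA"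
    using F.state_in_choi_extreme_rank by (simp add: C_def)
  ultimately show ?thesis by blast
qed

end
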